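(* Let $G$ be a finite weighted graph with $n$ vertices, and let $0<\lambda_1\le\lambda_2\le\cdots\le\lambda_{n-1}$ be the nonzero eigenvalues (with multiplicity) of the weighted Laplacian $\Delta$. Then $$\mathfrak D_{G,w}\sum_{v\in V(G)}\prod_{v'\neq v}w(v')=\prod_{i=1}^{n-1}\lambda_i\prod_{e\in E(G)^+}w(e).$$
   Context: A graph (in Serre's sense) has vertices $V(G)$, oriented edges $E(G)$, maps $e\mapsto(o(e),t(e))$ and $e\mapsto\bar e$ with $\bar{\bar e}=e$, $\bar e\ne e$, $t(\bar e)=o(e)$. Standing assumptions: $G$ is connected, has no loops ($o(e)\ne t(e)$), multiple edges allowed. An orientation $E(G)^+$ is a subset with $E(G)=E(G)^+\sqcup\overline{E(G)^+}$. Weights: $w:E(G)\to\mathbb{Z}_{>0}$ with $w(\bar e)=w(e)$, and $w:V(G)\to\mathbb{Z}_{>0}$. $C_0(G,\mathbb{Z})$ is free on $V(G)$, $C_1(G,\mathbb{Z})$ free on $E(G)^+$ (with $\bar e=-e$), $\partial e=t(e)-o(e)$, $H_1(G,\mathbb{Z})=\ker\partial$. Pairing on $C_1$: $(e,e)=w(e)$, $(e,\bar e)=-w(e)$, $(e,e')=0$ otherwise; on $C_0$: $\langle v,v\rangle=w(v)$, $\langle v,v'\rangle=0$ for $v\ne v'$. $\partial^*$ is the adjoint of $\partial$ for these pairings, $\partial^*(v)=\sum_{t(e)=v}\frac{w(v)}{w(e)}e$, and the weighted Laplacian is $\Delta=\partial\partial^*$, $\Delta(v)=\sum_{t(e)=v}\frac{w(v)}{w(e)}(v-o(e))$,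 acting on $C_0(G,\mathbb{R})$; it is self-adjoint, nonnegative, and its kernel is one-dimensional. The discriminant is $\mathfrak D_{G,w}=|\det((\varphi_i,\varphi_j))_{1\le i,j\le h}|$ for a $\mathbb{Z}$-basis $\varphi_1,\dots,\varphi_h$ of $H_1(G,\mathbb{Z})$. *)

theory Defs
  imports
    "HOL-Analysis.Finite_Function_Topology"
    "Graph_Theory.Graph_Theory"
    "Jordan_Normal_Form.Determinant"
begin

text \<open>
  A graph in Serre's sense is a bidirected digraph: o(e) is \<open>tail G e\<close>, t(e) is
  \<open>head G e\<close> and the reversal of arcs is \<open>arev\<close>.  The library convention that
  \<open>arev\<close> is the identity outside \<open>arcs G\<close> only fixes irrelevant values.
\<close>

locale weighted_graph =
  fin_digraph G + loopfree_digraph G + bidirected_digraph G arev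
  for G :: "('a, 'b) pre_digraph" and arev :: "'b \<Rightarrow> 'b" +
  fixes Ep :: "'b set" and we :: "'b \<Rightarrow> nat" and wv :: "'a \<Rightarrow> nat"
  assumes conn: "Digraph_Component.connected G"
    and orientation_un: "Ep \<union> arev ` Ep = arcs G"
    and orientation_disj: "Ep \<inter> arev ` Ep = {}"
    and we_pos: "e \<in> arcs G \<Longrightarrow> 0 < we e"
    and we_arev: "e \<in> arcs G \<Longrightarrow> we (arev e) = we e"
    and wv_pos: "v \<in> verts G \<Longrightarrow> 0 < wv v"

text \<open>
  Chains with coefficients in \<open>'r\<close> are finitely supported functions; the module of
  0-chains is \<open>chains (verts G)\<close>, that of 1-chains is \<open>chains Ep\<close>.
\<close>

definition chains :: "'x set \<Rightarrow> ('x \<Rightarrow>\<^sub>0 'r::zero) set" where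
  "chains S = {c. Poly_Mapping.keys c \<subseteq> S}"

definition arc_chain :: "('b \<Rightarrow> 'b) \<Rightarrow> 'b set \<Rightarrow> 'b \<Rightarrow> ('b \<Rightarrow>\<^sub>0 'r::comm_ring_1)" where
  "arc_chain arev Ep e =
     (if e \<in> Ep then Poly_Mapping.single e 1 else - Poly_Mapping.single (arev e) 1)"

definition boundary ::
  "('a, 'b) pre_digraph \<Rightarrow> ('b \<Rightarrow>\<^sub>0 'r::comm_ring_1) \<Rightarrow> ('a \<Rightarrow>\<^sub>0 'r)" where
  "boundary G c = (\<Sum>e\<in>Poly_Mapping.keys c.
     Poly_Mapping.single (head G e) (Poly_Mapping.lookup c e) -
     Poly_Mapping.single (tail G e) (Poly_Mapping.lookup c e))"

definition H1 :: "('a, 'b) pre_digraph \<Rightarrow> 'b set \<Rightarrow> ('b \<Rightarrow>\<^sub>0 int) set" where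
  "H1 G Ep = {c \<in> chains Ep. boundary G c = 0}"

text \<open>
  The bilinear pairing for which the generators are orthogonal and a generator \<open>x\<close> pairs
  with itself to \<open>w x\<close>; it serves both 0-chains and 1-chains.
\<close>

definition pairing :: "('x \<Rightarrow> nat) \<Rightarrow> ('x \<Rightarrow>\<^sub>0 'r) \<Rightarrow> ('x \<Rightarrow>\<^sub>0 'r) \<Rightarrow> 'r::comm_ring_1" where
  "pairing w c d = (\<Sum>x\<in>Poly_Mapping.keys c.
     of_nat (w x) * Poly_Mapping.lookup c x * Poly_Mapping.lookup d x)"

definition coboundary ::
  "('a, 'b) pre_digraph \<Rightarrow> ('b \<Rightarrow> 'b) \<Rightarrow> 'b set \<Rightarrow> ('b \<Rightarrow> nat) \<Rightarrow> ('a \<Rightarrow> nat) \<Rightarrow>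
   ('a \<Rightarrow>\<^sub>0 real) \<Rightarrow> ('b \<Rightarrow>\<^sub>0 real)" where
  "coboundary G arev Ep we wv f = (\<Sum>v\<in>Poly_Mapping.keys f. Poly_Mapping.lookup f v *\<^sub>R
     (\<Sum>e | e \<in> arcs G \<and> head G e = v. (real (wv v) / real (we e)) *\<^sub>R arc_chain arev Ep e))"

definition laplacian ::
  "('a, 'b) pre_digraph \<Rightarrow> ('b \<Rightarrow> 'b) \<Rightarrow> 'b set \<Rightarrow> ('b \<Rightarrow> nat) \<Rightarrow> ('a \<Rightarrow> nat) \<Rightarrow>
   ('a \<Rightarrow>\<^sub>0 real) \<Rightarrow> ('a \<Rightarrow>\<^sub>0 real)" where
  "laplacian G arev Ep we wv f = boundary G (coboundary G arev Ep we wv f)"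

definition eigenspace ::
  "('a, 'b) pre_digraph \<Rightarrow> ('b \<Rightarrow> 'b) \<Rightarrow> 'b set \<Rightarrow> ('b \<Rightarrow> nat) \<Rightarrow> ('a \<Rightarrow> nat) \<Rightarrow>
   real \<Rightarrow> ('a \<Rightarrow>\<^sub>0 real) set" where
  "eigenspace G arev Ep we wv x =
     {f \<in> chains (verts G). laplacian G arev Ep we wv f = x *\<^sub>R f}"

text \<open>
  The sorted list of nonzero eigenvalues, each repeated according to its multiplicity.
  As the Laplacian is self-adjoint, the multiplicity is the dimension of the eigenspace.
\<close>

definition nonzero_eigenvalues ::
  "('a, 'b) pre_digraph \<Rightarrow> ('b \<Rightarrow> 'b) \<Rightarrow> 'b set \<Rightarrow> ('b \<Rightarrow> nat) \<Rightarrow> ('a \<Rightarrow> nat) \<Rightarrow>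
   real list \<Rightarrow> bool" where
  "nonzero_eigenvalues G arev Ep we wv lam \<longleftrightarrow> sorted lam \<and>
     (\<forall>x. count_list lam x = (if x = 0 then 0 else dim (eigenspace G arev Ep we wv x)))"

definition int_basis :: "('b \<Rightarrow>\<^sub>0 int) set \<Rightarrow> ('b \<Rightarrow>\<^sub>0 int) list \<Rightarrow> bool" where
  "int_basis M \<phi> \<longleftrightarrow> distinct \<phi> \<and>
     \<not> Modules.module.dependent frag_cmul (set \<phi>) \<and>
     Modules.module.span frag_cmul (set \<phi>) = M"

definition gram :: "('b \<Rightarrow> nat) \<Rightarrow> ('b \<Rightarrow>\<^sub>0 int) list \<Rightarrow> int mat" where
  "gram we \<phi> = mat (length \<phi>) (length \<phi>) (\<lambda>(i, j). pairing we (\<phi> ! i) (\<phi> ! j))"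

definition discriminant ::
  "('a, 'b) pre_digraph \<Rightarrow> 'b set \<Rightarrow> ('b \<Rightarrow> nat) \<Rightarrow> int" where
  "discriminant G Ep we =
     (THE d. \<exists>\<phi>. int_basis (H1 G Ep) \<phi> \<and> d = \<bar>Determinant.det (gram we \<phi>)\<bar>)"

lemma module_frag_cmul: "Modules.module frag_cmul"
  by unfold_locales (simp_all add: frag_cmul_distrib frag_cmul_distrib2)

lemma boundary_superset:
  assumes "finite S" "Poly_Mapping.keys c \<subseteq> S"
  shows "boundary G c = (\<Sum>e\<in>S.
     Poly_Mapping.single (head G e) (Poly_Mapping.lookup c e) -
     Poly_Mapping.single (tail G e) (Poly_Mapping.lookup c e))"
  unfolding boundary_def
  by (rule sum.mono_neutral_left) (use assms in \<open>auto simp: in_keys_iff\<close>)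

lemma pairing_superset:
  assumes "finite S" "Poly_Mapping.keys c \<subseteq> S"
  shows "pairing w c d = (\<Sum>x\<in>S.
     of_nat (w x) * Poly_Mapping.lookup c x * Poly_Mapping.lookup d x)"
  unfolding pairing_def
  by (rule sum.mono_neutral_left) (use assms in \<open>auto simp: in_keys_iff\<close>)

lemma boundary_add: "boundary G (c + d) = boundary G c + boundary G d"
proof -
  let ?S = "Poly_Mapping.keys c \<union> Poly_Mapping.keys d"
  have "Poly_Mapping.keys (c + d) \<subseteq> ?S" by (rule Poly_Mapping.keys_add)
  then show ?thesis
    by (simp add: boundary_superset[of ?S] lookup_add single_add flip: sum.distrib)
       (rule sum.cong, simp_all)
qed

lemma lookup_scaleR_real:
  "Poly_Mapping.lookup (a *\<^sub>R c) x = a * Poly_Mapping.lookup (c :: 'x \<Rightarrow>\<^sub>0 real) x"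
proof -
  have "finite {x. a * Poly_Mapping.lookup c x \<noteq> 0}"
    by (rule finite_subset[OF _ finite_keys[of c]]) (auto simp: in_keys_iff)
  then show ?thesis
    by (simp add: scaleR_poly_mapping_def Abs_poly_mapping_inverse)
qed

lemma boundary_scaleR: "boundary G (a *\<^sub>R c) = a *\<^sub>R boundary G (c :: 'b \<Rightarrow>\<^sub>0 real)"
proof -
  have "Poly_Mapping.keys (a *\<^sub>R c) \<subseteq> Poly_Mapping.keys c"
    by (auto simp: in_keys_iff lookup_scaleR_real)
  moreover have "Poly_Mapping.single k (a * y) = a *\<^sub>R Poly_Mapping.single k y" for k :: 'a and y
    by (rule poly_mapping_eqI) (simp add: lookup_single when_def lookup_scaleR_real)
  ultimately show ?thesis
    by (simp add: boundary_superset[of "Poly_Mapping.keys c"] scaleR_sum_right scaleR_diff_right lookup_scaleR_real)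
qed

lemma boundary_sum_scaleR:
  "finite A \<Longrightarrow> boundary G (\<Sum>i\<in>A. a i *\<^sub>R c i :: 'b \<Rightarrow>\<^sub>0 real) = (\<Sum>i\<in>A. a i *\<^sub>R boundary G (c i))"
  by (induction A rule: finite_induct)
     (simp_all add: boundary_add boundary_scaleR, simp add: boundary_def)

context weighted_graph
begin

lemma Ep_arcs: "Ep \<subseteq> arcs G"
  using orientation_un by auto

lemma arev_Ep: "e \<in> arcs G \<Longrightarrow> e \<notin> Ep \<Longrightarrow> arev e \<in> Ep"
  using orientation_un by auto

lemma arc_chain_arev:
  "e \<in> arcs G \<Longrightarrow> arc_chain arev Ep (arev e) = - arc_chain arev Ep e"
  using orientation_disj arev_Ep by (auto simp: arc_chain_def)

lemma boundary_arc_chain: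
  assumes "e \<in> arcs G"
  shows "boundary G (arc_chain arev Ep e :: 'b \<Rightarrow>\<^sub>0 real) =
    Poly_Mapping.single (head G e) 1 - Poly_Mapping.single (tail G e) 1"
  using assms
  by (auto simp: arc_chain_def boundary_def single_uminus)

text \<open>The pairing of 1-chains and the Laplacian on generators.\<close>

lemma pairing_arc_chain:
  assumes "e \<in> arcs G" "e' \<in> arcs G"
  shows "pairing we (arc_chain arev Ep e) (arc_chain arev Ep e' :: 'b \<Rightarrow>\<^sub>0 'r::comm_ring_1) =
    (if e' = e then of_nat (we e) else if e' = arev e then - of_nat (we e) else 0)"
  using assms orientation_disj arev_Ep we_arev arev_neq
  by (auto simp: arc_chain_def pairing_superset[of "{e}"] pairing_superset[of "{arev e}"]
       lookup_single when_def) (metis arev_arev)+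

lemma laplacian_vertex:
  assumes "v \<in> verts G"
  shows "laplacian G arev Ep we wv (Poly_Mapping.single v 1) =
    (\<Sum>e | e \<in> arcs G \<and> head G e = v. (real (wv v) / real (we e)) *\<^sub>R
       (Poly_Mapping.single v 1 - Poly_Mapping.single (tail G e) 1))"
  by (simp add: laplacian_def coboundary_def boundary_sum_scaleR boundary_arc_chain)

lemma lookup_arc_chain:
  assumes "e \<in> Ep" "a \<in> arcs G"
  shows "Poly_Mapping.lookup (arc_chain arev Ep a :: 'b \<Rightarrow>\<^sub>0 real) e =
    (if a = e then 1 else 0) - (if a = arev e then 1 else 0)"
proof -
  have "a \<in> Ep \<Longrightarrow> a \<noteq> arev e"
    using assms orientation_disj by auto
  moreover have "arev a = e \<longleftrightarrow> a = arev e"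
    by (metis arev_arev)
  ultimately show ?thesis
    using assms by (auto simp: arc_chain_def lookup_single when_def)
qed

lemma lookup_coboundary:
  assumes e: "e \<in> Ep"
  shows "Poly_Mapping.lookup (coboundary G arev Ep we wv f) e =
    (real (wv (head G e)) * Poly_Mapping.lookup f (head G e) -
     real (wv (tail G e)) * Poly_Mapping.lookup f (tail G e)) / real (we e)"
proof -
  have eG: "e \<in> arcs G" using e Ep_arcs by auto
  let ?A = "\<lambda>v. {a. a \<in> arcs G \<and> head G a = v}"
  have inner: "(\<Sum>a\<in>?A v. (real (wv v) / real (we a)) *
       Poly_Mapping.lookup (arc_chain arev Ep a :: 'b \<Rightarrow>\<^sub>0 real) e) =
     real (wv v) / real (we e) *
       ((if head G e = v then 1 else 0) - (if tail G e = v then 1 else 0))" for v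
  proof -
    have "(\<Sum>a\<in>?A v. (real (wv v) / real (we a)) *
        Poly_Mapping.lookup (arc_chain arev Ep a :: 'b \<Rightarrow>\<^sub>0 real) e) =
      (\<Sum>a\<in>?A v. (if a = e then real (wv v) / real (we e) else 0) -
                   (if a = arev e then real (wv v) / real (we e) else 0))"
      using we_arev[OF eG] by (intro sum.cong) (auto simp: lookup_arc_chain[OF e])
    also have "\<dots> = (\<Sum>a\<in>?A v. if a = e then real (wv v) / real (we e) else 0) -
                   (\<Sum>a\<in>?A v. if a = arev e then real (wv v) / real (we e) else 0)"
      by (rule sum_subtractf)
    finally show ?thesis
      using eG by (auto simp: sum.delta)
  qed
  have "Poly_Mapping.lookup (coboundary G arev Ep we wv f) e =
    (\<Sum>v\<in>Poly_Mapping.keys f. Poly_Mapping.lookup f v * (real (wv v) / real (we e) *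
       ((if head G e = v then 1 else 0) - (if tail G e = v then 1 else 0))))"
    unfolding coboundary_def by (simp only: lookup_sum lookup_scaleR_real inner)
  also have "\<dots> = (\<Sum>v\<in>Poly_Mapping.keys f.
       (if head G e = v then Poly_Mapping.lookup f v * real (wv v) / real (we e) else 0) -
       (if tail G e = v then Poly_Mapping.lookup f v * real (wv v) / real (we e) else 0))"
    by (intro sum.cong) auto
  finally show ?thesis
    by (auto simp: sum_subtractf in_keys_iff diff_divide_distrib mult.commute)
qed

lemma coboundary_adjoint:
  assumes c: "c \<in> chains Ep" and f: "f \<in> chains (verts G)"
  shows "pairing we c (coboundary G arev Ep we wv f) = pairing wv (boundary G c) f"
proof -
  let ?c = "Poly_Mapping.lookup c" and ?f = "Poly_Mapping.lookup f"
  have K: "Poly_Mapping.keys c \<subseteq> Ep" using c by (simp add: chains_def)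
  have V: "Poly_Mapping.keys (boundary G c) \<subseteq> verts G"
  proof
    fix v assume v: "v \<in> Poly_Mapping.keys (boundary G c)"
    show "v \<in> verts G"
    proof (rule ccontr)
      assume nv: "v \<notin> verts G"
      have "Poly_Mapping.lookup (boundary G c) v = 0"
        unfolding boundary_def lookup_sum
        by (rule sum.neutral) (use K Ep_arcs nv in \<open>auto simp: lookup_minus lookup_single when_def\<close>)
      with v show False by (simp add: in_keys_iff)
    qed
  qed
  have "pairing we c (coboundary G arev Ep we wv f) =
    (\<Sum>e\<in>Poly_Mapping.keys c. ?c e * (real (wv (head G e)) * ?f (head G e) -
       real (wv (tail G e)) * ?f (tail G e)))"
    unfolding pairing_def
  proof (rule sum.cong)
    fix e assume "e \<in> Poly_Mapping.keys c"
    then have "e \<in> Ep" "0 < we e" using K Ep_arcs we_pos by auto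
    then show "real (we e) * ?c e * Poly_Mapping.lookup (coboundary G arev Ep we wv f) e =
        ?c e * (real (wv (head G e)) * ?f (head G e) - real (wv (tail G e)) * ?f (tail G e))"
      by (simp add: lookup_coboundary)
  qed simp
  also have "\<dots> = (\<Sum>e\<in>Poly_Mapping.keys c. \<Sum>v\<in>verts G.
      real (wv v) * ((if head G e = v then ?c e else 0) - (if tail G e = v then ?c e else 0)) * ?f v)"
  proof (rule sum.cong)
    fix e assume "e \<in> Poly_Mapping.keys c"
    then have e: "e \<in> arcs G" using K Ep_arcs by auto
    have "(\<Sum>v\<in>verts G. real (wv v) *
        ((if head G e = v then ?c e else 0) - (if tail G e = v then ?c e else 0)) * ?f v) =
      (\<Sum>v\<in>verts G. (if head G e = v then real (wv v) * ?c e * ?f v else 0) -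
        (if tail G e = v then real (wv v) * ?c e * ?f v else 0))"
      by (intro sum.cong) (auto simp: algebra_simps)
    also have "\<dots> = real (wv (head G e)) * ?c e * ?f (head G e) -
        real (wv (tail G e)) * ?c e * ?f (tail G e)"
      using e by (simp add: sum_subtractf)
    finally show "?c e * (real (wv (head G e)) * ?f (head G e) -
        real (wv (tail G e)) * ?f (tail G e)) = (\<Sum>v\<in>verts G. real (wv v) *
        ((if head G e = v then ?c e else 0) - (if tail G e = v then ?c e else 0)) * ?f v)"
      by (simp add: algebra_simps)
  qed simp
  also have "\<dots> = pairing wv (boundary G c) f"
    unfolding pairing_superset[OF finite_verts V]
    by (subst sum.swap)
       (simp add: boundary_def lookup_sum lookup_minus lookup_single when_def
          sum_distrib_left sum_distrib_right)
  finally show ?thesis .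
qed

end

end

theory Submission
  imports Defs "Jordan_Normal_Form.Jordan_Normal_Form_Existence"
    "Jordan_Normal_Form.Jordan_Normal_Form_Uniqueness"
begin

text \<open>
  Let \<open>D\<close> be the incidence matrix and \<open>L = D W D\<^sup>T\<close>, where \<open>W\<close> is the diagonal matrix of the
  reciprocal edge weights, so that \<open>\<Delta> = L V\<close> with \<open>V\<close> the diagonal matrix of the vertex weights.
  Comparing the linear coefficients of the characteristic polynomial of \<open>\<Delta>\<close>, the product of
  the nonzero eigenvalues is the sum of the principal minors of \<open>L V\<close> of order \<open>n - 1\<close>.  The minor
  that omits the vertex \<open>r\<close> is \<open>det L\<^sub>r\<close> times the product of the other vertex weights, and
  \<open>det L\<^sub>r\<close> times the product of the edge weights is the discriminant, whatever \<open>r\<close> is: a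
  spanning tree splits \<open>D\<^sub>r\<close> into a unimodular block and a block expressing the fundamental
  cycles, and the claim becomes Sylvester's identity
  \<open>det (X + B Y C) = det X det Y det (Y\<^sup>-\<^sup>1 + C X\<^sup>-\<^sup>1 B)\<close>.
\<close>

section \<open>Matrices indexed by lists\<close>

text \<open>Rows and columns are indexed by the vertices and edges in the lists, so that an entry
  mentions them directly and a product becomes a sum over a set once the middle list is distinct.
  The lists fix only the order.\<close>

definition fmat :: "'x list \<Rightarrow> 'y list \<Rightarrow> ('x \<Rightarrow> 'y \<Rightarrow> 'r) \<Rightarrow> 'r mat" where
  "fmat xs ys f = mat (length xs) (length ys) (\<lambda>(i, j). f (xs ! i) (ys ! j))"

lemma fmat_carrier [simp]: "fmat xs ys f \<in> carrier_mat (length xs) (length ys)"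
  by (simp add: fmat_def)

lemma fmat_cong:
  "(\<And>x y. x \<in> set xs \<Longrightarrow> y \<in> set ys \<Longrightarrow> f x y = g x y) \<Longrightarrow> fmat xs ys f = fmat xs ys g"
  by (auto simp: fmat_def)

lemma sum_nth_distinct:
  "distinct xs \<Longrightarrow> (\<Sum>i = 0..<length xs. g (xs ! i)) = (\<Sum>x\<in>set xs. g x)"
  by (rule sum.reindex_bij_betw) (auto simp: atLeast0LessThan intro: bij_betw_nth)

lemma fmat_mult:
  fixes f :: "'x \<Rightarrow> 'y \<Rightarrow> 'r::comm_semiring_0"
  assumes "distinct ys"
  shows "fmat xs ys f * fmat ys zs g = fmat xs zs (\<lambda>x z. \<Sum>y\<in>set ys. f x y * g y z)"
  by (rule eq_matI) (auto simp: fmat_def scalar_prod_def intro!: sum_nth_distinct[OF assms])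

lemma fmat_add: "fmat xs ys f + fmat xs ys g = fmat xs ys (\<lambda>x y. f x y + g x y)"
  by (rule eq_matI) (auto simp: fmat_def)

lemma fmat_one:
  "distinct xs \<Longrightarrow> fmat xs xs (\<lambda>x y. if x = y then 1 else 0) = 1\<^sub>m (length xs)"
  by (rule eq_matI) (auto simp: fmat_def nth_eq_iff_index_eq)

lemma fmat_transpose: "transpose_mat (fmat xs ys f) = fmat ys xs (\<lambda>y x. f x y)"
  by (rule eq_matI) (auto simp: fmat_def)

lemma map_mat_fmat: "map_mat h (fmat xs ys f) = fmat xs ys (\<lambda>x y. h (f x y))"
  by (rule eq_matI) (auto simp: fmat_def)

lemma det_fmat_diag:
  assumes "distinct xs"
  shows "Determinant.det (fmat xs xs (\<lambda>x y. if x = y then w x else 0)) = (\<Prod>x\<in>set xs. w x)"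
proof -
  have "Determinant.det (fmat xs xs (\<lambda>x y. if x = y then w x else 0)) =
      prod_list (diag_mat (fmat xs xs (\<lambda>x y. if x = y then w x else 0)))"
    by (rule det_upper_triangular[of _ "length xs"])
      (use assms in \<open>auto simp: fmat_def nth_eq_iff_index_eq\<close>)
  also have "diag_mat (fmat xs xs (\<lambda>x y. if x = y then w x else 0)) = map w xs"
    by (rule nth_equalityI) (auto simp: diag_mat_def fmat_def)
  finally show ?thesis
    using assms by (simp add: prod.distinct_set_conv_list)
qed

lemma fmat_mult_diag:
  fixes f :: "'x \<Rightarrow> 'y \<Rightarrow> 'r::comm_semiring_1"
  assumes "distinct ys"
  shows "fmat xs ys f * fmat ys ys (\<lambda>y z. if y = z then w y else 0) = fmat xs ys (\<lambda>x y. f x y * w y)"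
proof -
  have "(\<Sum>y\<in>set ys. f x y * (if y = z then w y else 0)) = f x z * w z" if "z \<in> set ys" for x z
    using that by (simp add: if_distrib[of "(*) _"] cong: if_cong)
  then show ?thesis
    using assms by (simp add: fmat_mult cong: fmat_cong)
qed

text \<open>Regroups the second summand so that the products \<open>D * C\<close> and
  \<open>B * E\<close> can each be rewritten as a whole. Later \<open>D\<close> is the tree block of
  the incidence matrix, \<open>E\<close> its transpose, and both products follow from the cycle
  condition.\<close>

lemma mat_mult_sum_sandwich:
  fixes D :: "'r::comm_ring_1 mat"
  assumes "D \<in> carrier_mat n t" "Y \<in> carrier_mat t t" "C \<in> carrier_mat t m"
    "X \<in> carrier_mat m m" "B \<in> carrier_mat m t" "E \<in> carrier_mat t k"
  shows "D * (Y + C * X * B) * E = D * Y * E + (D * C) * X * (B * E)"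
proof -
  note A = assms
  have "D * (C * X * B) = D * C * X * B"
    using A by (simp add: assoc_mult_mat[of _ n t _ m _ m] assoc_mult_mat[of _ n t _ m _ t]
        assoc_mult_mat[of _ n m _ m _ t] assoc_mult_mat[of _ t m _ m _ t])
  then have "D * (C * X * B) * E = (D * C) * X * (B * E)"
    using A by (simp add: assoc_mult_mat[of _ n m B t E k])
  moreover have "D * (Y + C * X * B) * E = D * Y * E + D * (C * X * B) * E"
    using A by (simp add: mult_add_distrib_mat[of D n t] add_mult_distrib_mat[of _ n t])
  ultimately show ?thesis by simp
qed

lemma fmat_map: "fmat (map h xs) (map k ys) f = fmat xs ys (\<lambda>x y. f (h x) (k y))"
  by (rule eq_matI) (auto simp: fmat_def)

lemma mat_delete_fmat:
  assumes "k < length xs"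
  shows "mat_delete (fmat xs xs f) k k =
    fmat (take k xs @ drop (Suc k) xs) (take k xs @ drop (Suc k) xs) f"
  by (rule eq_matI) (use assms in \<open>auto simp: mat_delete_def fmat_def nth_append\<close>)

text \<open>Both sides arise from the block matrix with rows \<open>X\<close>, \<open>- B\<close>
  and \<open>C\<close>, \<open>Y'\<close>. Clearing its lower left block by column operations leaves
  \<open>X + B * Y * C\<close> and \<open>Y'\<close> on the diagonal; clearing the upper right one
  leaves \<open>X\<close> and \<open>Y' + C * X' * B\<close>. Inverses are passed as explicit
  matrices, so no division is involved.\<close>

lemma det_sylvester:
  fixes X :: "'a::idom mat"
  assumes X: "X \<in> carrier_mat n n" "X' \<in> carrier_mat n n" "X * X' = 1\<^sub>m n"
    and Y: "Y \<in> carrier_mat m m" "Y' \<in> carrier_mat m m" "Y' * Y = 1\<^sub>m m"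
    and B: "B \<in> carrier_mat n m" and C: "C \<in> carrier_mat m n"
  shows "Determinant.det (X + B * Y * C) =
    Determinant.det X * Determinant.det Y * Determinant.det (Y' + C * X' * B)"
proof -
  let ?M = "four_block_mat X (- B) C Y'"
  have M: "?M \<in> carrier_mat (n + m) (n + m)" using X Y by auto
  have 1: "?M * four_block_mat (1\<^sub>m n) (0\<^sub>m n m) (- (Y * C)) (1\<^sub>m m) =
      four_block_mat (X + B * Y * C) (- B) (0\<^sub>m m n) Y'"
  proof -
    have "X * 1\<^sub>m n + (- B) * (- (Y * C)) = X + B * Y * C"
      using X Y B C by (simp add: assoc_mult_mat[of B n m Y m C n])
    moreover have "Y' * (Y * C) = C"
      using Y C by (simp flip: assoc_mult_mat[of Y' m m Y m C n])
    ultimately show ?thesis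
      using X Y B C by (subst mult_four_block_mat[of _ n n _ m _ m _ _ n _ m]) auto
  qed
  have 2: "?M * four_block_mat (1\<^sub>m n) (X' * B) (0\<^sub>m m n) (1\<^sub>m m) =
      four_block_mat X (0\<^sub>m n m) C (Y' + C * X' * B)"
  proof -
    have "X * (X' * B) = B"
      using X B by (simp flip: assoc_mult_mat[of X n n X' n B m])
    moreover have "C * (X' * B) + Y' = Y' + C * X' * B"
      using X Y B C by (subst comm_add_mat[of _ m m]) (auto simp: assoc_mult_mat[of C m n X' n B m])
    ultimately show ?thesis
      using X Y B C by (subst mult_four_block_mat[of _ n n _ m _ m _ _ n _ m]) auto
  qed
  have "Determinant.det ?M = Determinant.det (X + B * Y * C) * Determinant.det Y'"
    using arg_cong[OF 1, of Determinant.det] X Y B C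
    by (subst (asm) det_mult[OF M])
      (auto simp: det_four_block_mat_upper_right_zero[of _ n _ m]
        det_four_block_mat_lower_left_zero[of _ n _ m])
  moreover have "Determinant.det ?M = Determinant.det X * Determinant.det (Y' + C * X' * B)"
    using arg_cong[OF 2, of Determinant.det] X Y B C
    by (subst (asm) det_mult[OF M])
      (auto simp: det_four_block_mat_upper_right_zero[of _ n _ m]
        det_four_block_mat_lower_left_zero[of _ n _ m])
  moreover have "Determinant.det Y' * Determinant.det Y = 1"
    using arg_cong[OF Y(3), of Determinant.det] by (simp add: det_mult[OF Y(2,1)])
  ultimately show ?thesis
    by (metis mult.assoc mult.commute mult.right_neutral)
qed

lemma jordan_matrix_diag:
  "jordan_matrix (map (Pair 1) ds) =
    mat (length ds) (length ds) (\<lambda>(i, j). if i = j then ds ! i else 0)"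
proof (induction ds)
  case Nil
  then show ?case by (auto simp: jordan_matrix_def)
next
  case (Cons d ds)
  have s: "sum_list (map fst (map (Pair (1::nat)) ds)) = length ds"
    by (induction ds) auto
  show ?case
    unfolding list.map jordan_matrix_Cons s Cons.IH
    by (rule eq_matI) (auto simp: nth_Cons')
qed

section \<open>Diagonalization of symmetrizable matrices\<close>

lemma mat_mult_index_sum:
  assumes "A \<in> carrier_mat n n" "B \<in> carrier_mat n n" "i < n" "j < n"
  shows "(A * B) $$ (i, j) = (\<Sum>k<n. A $$ (i, k) * B $$ (k, j))"
  using assms by (auto simp: scalar_prod_def atLeast0LessThan)

lemma similar_mat_wit_commute:
  assumes A: "A \<in> carrier_mat n n" and wit: "similar_mat_wit A B P Q"
  shows "A * P = P * B" "Q * A = B * Q"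
proof -
  note w = similar_mat_witD2[OF A wit]
  have "A * P = P * B * (Q * P)"
    unfolding w(3) by (rule assoc_mult_mat[of _ n n _ n _ n]) (use w in auto)
  then show "A * P = P * B" using w by simp
  have "Q * A = Q * P * (B * Q)"
    unfolding w(3) using w(4-7)
    by (simp add: assoc_mult_mat[of P n n B n Q n] assoc_mult_mat[of Q n n P n "B * Q" n])
  then show "Q * A = B * Q" using w by simp
qed

lemma mult_mat_vec_nth:
  assumes "A \<in> carrier_mat n n" "v \<in> carrier_vec n" "i < n"
  shows "(A *\<^sub>v v) $ i = (\<Sum>j<n. A $$ (i, j) * v $ j)"
  using assms by (auto simp: scalar_prod_def atLeast0LessThan)

text \<open>The hypothesis \<open>sym\<close> makes \<open>A\<close> self-adjoint for the bilinear
  form with weights \<open>w\<close>: expand both sides and exchange the sums. No conjugation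
  occurs, so the same statement serves real vectors and pairs of complex conjugate ones.\<close>

lemma weighted_form_swap:
  fixes A :: "'r::comm_semiring_0 mat"
  assumes A: "A \<in> carrier_mat n n"
    and sym: "\<And>i j. i < n \<Longrightarrow> j < n \<Longrightarrow> w i * A $$ (i, j) = w j * A $$ (j, i)"
    and x: "x \<in> carrier_vec n" and y: "y \<in> carrier_vec n"
  shows "(\<Sum>i<n. w i * x $ i * (A *\<^sub>v y) $ i) = (\<Sum>i<n. w i * (A *\<^sub>v x) $ i * y $ i)"
proof -
  have "(\<Sum>i<n. w i * x $ i * (A *\<^sub>v y) $ i) = (\<Sum>i<n. \<Sum>j<n. (w i * A $$ (i, j)) * x $ i * y $ j)"
    using A y by (intro sum.cong) (simp_all add: mult_mat_vec_nth sum_distrib_left mult_ac del: index_mult_mat_vec)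
  also have "\<dots> = (\<Sum>i<n. \<Sum>j<n. (w j * A $$ (j, i)) * x $ i * y $ j)"
    by (intro sum.cong) (simp_all add: sym)
  also have "\<dots> = (\<Sum>j<n. \<Sum>i<n. (w j * A $$ (j, i)) * x $ i * y $ j)"
    by (rule sum.swap)
  also have "\<dots> = (\<Sum>i<n. w i * (A *\<^sub>v x) $ i * y $ i)"
    using A x by (intro sum.cong) (simp_all add: mult_mat_vec_nth sum_distrib_left sum_distrib_right mult_ac del: index_mult_mat_vec)
  finally show ?thesis .
qed

text \<open>Eigenvalues of a self-adjoint operator are real. Over the complex numbers the polynomial
  factors; for an eigenvector \<open>v\<close> the form of its conjugate against \<open>A v\<close>
  equals both \<open>a\<close> and \<open>cnj a\<close> times the weighted square norm of
  \<open>v\<close>, which is positive.\<close>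

lemma symmetrizable_char_poly_splits:
  fixes A :: "real mat" and w :: "nat \<Rightarrow> real"
  assumes A: "A \<in> carrier_mat n n"
    and w: "\<And>i. i < n \<Longrightarrow> 0 < w i"
    and sym: "\<And>i j. i < n \<Longrightarrow> j < n \<Longrightarrow> w i * A $$ (i, j) = w j * A $$ (j, i)"
  obtains as where "char_poly A = (\<Prod>a\<leftarrow>as. [:- a, 1:])"
proof -
  let ?C = "map_mat complex_of_real A"
  have C: "?C \<in> carrier_mat n n" using A by simp
  obtain as where as: "char_poly ?C = (\<Prod>a\<leftarrow>as. [:- a, 1:])"
    using char_poly_factorized[OF C] by blast
  have real: "of_real (Re a) = a" if "a \<in> set as" for a
  proof -
    have "poly (char_poly ?C) a = 0"
      using that unfolding as poly_prod_list by (auto simp: prod_list_zero_iff)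
    then obtain v where "eigenvector ?C v a"
      using eigenvalue_root_char_poly[OF C] by (auto simp: eigenvalue_def)
    then have v: "v \<in> carrier_vec n" "v \<noteq> 0\<^sub>v n" "?C *\<^sub>v v = a \<cdot>\<^sub>v v"
      using A by (auto simp: eigenvector_def)
    \<comment> \<open>As \<open>A\<close> has real entries, the conjugate vector is an eigenvector
      for \<open>cnj a\<close>.\<close>
    let ?v = "map_vec cnj v"
    have cv: "?v \<in> carrier_vec n" using v by simp
    have Cv: "(?C *\<^sub>v ?v) $ i = cnj a * cnj (v $ i)" if "i < n" for i
    proof -
      have "(?C *\<^sub>v ?v) $ i = cnj ((?C *\<^sub>v v) $ i)"
        using A v(1) that by (simp add: mult_mat_vec_nth[OF C] del: index_mult_mat_vec)
      then show ?thesis using v that by simp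
    qed
    let ?w = "\<lambda>i. complex_of_real (w i)"
    let ?N = "\<Sum>i<n. w i * (cmod (v $ i))\<^sup>2"
    have "(\<Sum>i<n. ?w i * ?v $ i * (?C *\<^sub>v v) $ i) = (\<Sum>i<n. ?w i * (?C *\<^sub>v ?v) $ i * v $ i)"
      by (rule weighted_form_swap[OF C _ cv v(1)])
        (use A sym in \<open>simp flip: of_real_mult\<close>)
    also have "\<dots> = cnj a * of_real ?N"
      unfolding of_real_sum sum_distrib_left
    proof (rule sum.cong)
      fix i assume "i \<in> {..<n}"
      then have i: "i < n" by simp
      show "?w i * (?C *\<^sub>v ?v) $ i * v $ i = cnj a * complex_of_real (w i * (cmod (v $ i))\<^sup>2)"
        unfolding Cv[OF i] of_real_mult complex_norm_square by (simp only: mult_ac)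
    qed simp
    finally have "(\<Sum>i<n. ?w i * ?v $ i * (?C *\<^sub>v v) $ i) = cnj a * of_real ?N" .
    moreover have "(\<Sum>i<n. ?w i * ?v $ i * (?C *\<^sub>v v) $ i) = a * of_real ?N"
      unfolding of_real_sum sum_distrib_left
    proof (rule sum.cong)
      fix i assume "i \<in> {..<n}"
      then have "?v $ i = cnj (v $ i)" "(a \<cdot>\<^sub>v v) $ i = a * v $ i" using v(1) by simp_all
      then show "?w i * ?v $ i * (?C *\<^sub>v v) $ i = a * complex_of_real (w i * (cmod (v $ i))\<^sup>2)"
        unfolding v(3) of_real_mult complex_norm_square by (simp only: mult_ac)
    qed simp
    moreover have "?N > 0"
    proof -
      obtain i where "i < n" "v $ i \<noteq> 0"
        using v by (metis carrier_vecD eq_vecI index_zero_vec)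
      then show ?thesis
        using w by (intro sum_pos2[of _ i]) (auto simp: less_imp_le)
    qed
    ultimately have "cnj a * complex_of_real ?N = a * complex_of_real ?N" "complex_of_real ?N \<noteq> 0"
      by (simp_all only: of_real_eq_0_iff)
    then have "cnj a = a" by (simp only: mult_cancel_right simp_thms)
    then show ?thesis by (metis Reals_cnj_iff of_real_Re)
  qed
  \<comment> \<open>Embedding real polynomials into complex ones is injective, which brings the
    factorization back to the reals.\<close>
  interpret P: map_poly_inj_idom_hom "of_real :: real \<Rightarrow> complex" ..
  have "map_poly complex_of_real (char_poly A) = (\<Prod>a\<leftarrow>as. [:- a, 1:])"
    using as by (simp add: of_real_hom.char_poly_hom[OF A])
  also have "\<dots> = (\<Prod>a\<leftarrow>as. map_poly of_real [:- Re a, 1:])"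
    using real by (intro arg_cong[of _ _ prod_list] map_cong) auto
  also have "\<dots> = map_poly complex_of_real (\<Prod>a\<leftarrow>map Re as. [:- a, 1:])"
    by (simp only: P.hom_prod_list map_map o_def)
  finally have "char_poly A = (\<Prod>a\<leftarrow>map Re as. [:- a, 1:])"
    by (metis P.eq_iff)
  then show thesis by (rule that)
qed

text \<open>If \<open>A\<close> annihilates \<open>A x\<close>, self-adjointness turns the weighted
  square norm of \<open>A x\<close> into the form of \<open>A (A x)\<close> against
  \<open>x\<close>, which is zero. Positive weights then force \<open>A x = 0\<close>.\<close>

lemma symmetrizable_mat_kernel_square:
  fixes A :: "real mat" and w :: "nat \<Rightarrow> real"
  assumes A: "A \<in> carrier_mat n n"
    and w: "\<And>i. i < n \<Longrightarrow> 0 < w i"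
    and sym: "\<And>i j. i < n \<Longrightarrow> j < n \<Longrightarrow> w i * A $$ (i, j) = w j * A $$ (j, i)"
  shows "mat_kernel (A * A) = mat_kernel A"
proof -
  have "A *\<^sub>v x = 0\<^sub>v n" if x: "x \<in> carrier_vec n" and AAx: "A *\<^sub>v (A *\<^sub>v x) = 0\<^sub>v n" for x
  proof -
    have Ax: "A *\<^sub>v x \<in> carrier_vec n" using A x by simp
    have "(\<Sum>i<n. w i * (A *\<^sub>v x) $ i * (A *\<^sub>v x) $ i) = (\<Sum>i<n. w i * (A *\<^sub>v (A *\<^sub>v x)) $ i * x $ i)"
      by (rule weighted_form_swap[OF A sym Ax x])
    also have "\<dots> = 0" unfolding AAx by simp
    finally have "\<forall>i\<in>{..<n}. w i * (A *\<^sub>v x) $ i * (A *\<^sub>v x) $ i = 0"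
      using w by (subst (asm) sum_nonneg_eq_0_iff) (auto simp: mult.assoc less_imp_le simp del: index_mult_mat_vec)
    then show ?thesis
      using w A by (intro eq_vecI) (force simp del: index_mult_mat_vec)+
  qed
  then show ?thesis
    using A by (auto simp: mat_kernel_def assoc_mult_mat_vec[OF A A])
qed

text \<open>The transforming matrices are kept explicit because they are used later: the columns of
  \<open>P\<close> are eigenvectors and the rows of \<open>Q\<close> are the dual coordinate
  functionals.\<close>

lemma symmetrizable_diagonalizable:
  fixes A :: "real mat" and w :: "nat \<Rightarrow> real"
  assumes A: "A \<in> carrier_mat n n"
    and w: "\<And>i. i < n \<Longrightarrow> 0 < w i"
    and sym: "\<And>i j. i < n \<Longrightarrow> j < n \<Longrightarrow> w i * A $$ (i, j) = w j * A $$ (j, i)"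
  obtains ds P Q where "length ds = n"
    "similar_mat_wit A (mat n n (\<lambda>(i, j). if i = j then ds ! i else 0)) P Q"
proof -
  obtain as where "char_poly A = (\<Prod>a\<leftarrow>as. [:- a, 1:])"
    by (rule symmetrizable_char_poly_splits[OF A w sym])
  then obtain n_as where jnf: "jordan_nf A n_as"
    using jordan_nf_exists[OF A] by blast
  \<comment> \<open>the kernels of \<open>A - a\<close> and its square agree, so all Jordan blocks have size 1\<close>
  have "m = 1" if mem: "(m, a) \<in> set n_as" for m a
  proof -
    let ?C = "char_matrix A a"
    have C: "?C \<in> carrier_mat n n" using A by simp
    have K: "mat_kernel (?C * ?C) = mat_kernel ?C"
      by (rule symmetrizable_mat_kernel_square[OF C w])
        (use A sym in \<open>auto simp: char_matrix_def algebra_simps\<close>)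
    \<comment> \<open>The generalized eigenspace of order \<open>k\<close> has as dimension the sum
      of \<open>min k m\<close> over the sizes \<open>m\<close> of the blocks for \<open>a\<close>.
      Equality for orders 1 and 2 therefore holds term by term.\<close>
    have "dim_gen_eigenspace A a 2 = dim_gen_eigenspace A a 1"
      using C K by (simp add: dim_gen_eigenspace_def kernel_dim_def numeral_2_eq_2)
    moreover define ms where "ms = map fst [(n, e)\<leftarrow>n_as. e = a]"
    ultimately have eq: "sum_list (map (min 2) ms) = sum_list (map (min 1) ms)"
      by (simp add: dim_gen_eigenspace[OF jnf])
    have "\<forall>m\<in>set ms. min 2 m = min 1 m"
      using eq
    proof (induction ms)
      case (Cons m ms)
      have "sum_list (map (min 1) ms) \<le> sum_list (map (min 2) ms)"
        by (intro sum_list_mono) auto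
      with Cons show ?case by auto
    qed simp
    moreover have "m \<in> set ms" using mem by (force simp: ms_def)
    \<comment> \<open>Blocks of size 0 would satisfy the equation as well; a Jordan normal form has
      none.\<close>
    moreover have "m \<noteq> 0" using jnf mem by (force simp: jordan_nf_def)
    ultimately show ?thesis by force
  qed
  then have n_as: "n_as = map (Pair 1) (map snd n_as)"
    by (intro nth_equalityI) (auto simp: prod_eq_iff, metis nth_mem prod.collapse)
  obtain P Q where PQ: "similar_mat_wit A (jordan_matrix n_as) P Q"
    using jnf by (auto simp: jordan_nf_def similar_mat_def)
  then have "jordan_matrix n_as \<in> carrier_mat n n"
    using similar_mat_witD2[OF A] by blast
  then have "length n_as = n"
    using arg_cong[OF jordan_matrix_diag[of "map snd n_as"], of dim_row]
    unfolding n_as[symmetric] by auto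
  then show thesis
    using that[of "map snd n_as" P Q] PQ jordan_matrix_diag[of "map snd n_as"] n_as by simp
qed

section \<open>Linear coefficient of the characteristic polynomial\<close>

lemma poly_char_poly_0:
  fixes A :: "'a::field mat"
  assumes A: "A \<in> carrier_mat n n"
  shows "poly (char_poly A) 0 = (-1) ^ n * Determinant.det A"
proof -
  have "- char_matrix A 0 = (-1) \<cdot>\<^sub>m A"
    by (rule eq_matI) (use A in \<open>auto simp: char_matrix_def\<close>)
  then show ?thesis using A by (simp add: char_poly_matrix[OF A])
qed

text \<open>The derivative of the characteristic polynomial at 0 is computed twice. The root 0
  contributes a linear factor, leaving the product of the negated entries of \<open>as\<close>; the
  derivative formula gives the sum of the characteristic polynomials of the principal submatrices at
  0. The sign \<open>(-1) ^ m\<close> appears on both sides and cancels.\<close>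

lemma sum_principal_minors:
  fixes A :: "'a::field_char_0 mat"
  assumes A: "A \<in> carrier_mat (Suc m) (Suc m)"
    and cp: "char_poly A = (\<Prod>a\<leftarrow>0 # as. [:- a, 1:])" and m: "length as = m"
  shows "(\<Sum>i<Suc m. Determinant.det (mat_delete A i i)) = prod_list as"
proof -
  have "poly (pderiv (char_poly A)) 0 = (\<Prod>a\<leftarrow>as. - a)"
    unfolding cp by (simp add: pderiv_mult pderiv_pCons poly_prod_list o_def)
  also have "\<dots> = (-1) ^ m * prod_list as"
    unfolding m[symmetric] by (induction as) auto
  finally have "(\<Sum>i<Suc m. poly (char_poly (mat_delete A i i)) 0) = (-1) ^ m * prod_list as"
    by (simp add: pderiv_char_poly[OF A] poly_sum)
  moreover have "poly (char_poly (mat_delete A i i)) 0 = (-1) ^ m * Determinant.det (mat_delete A i i)" for i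
    by (rule poly_char_poly_0) (use A in \<open>simp add: mat_delete_def\<close>)
  ultimately show ?thesis by (simp flip: sum_distrib_left)
qed

section \<open>Integral bases and Gram determinants\<close>

lemma pairing_sum_left:
  fixes c :: "'i \<Rightarrow> 'x \<Rightarrow>\<^sub>0 int"
  assumes "finite I"
  shows "pairing w (\<Sum>i\<in>I. frag_cmul (a i) (c i)) d = (\<Sum>i\<in>I. a i * pairing w (c i) d)"
proof -
  let ?S = "\<Union>i\<in>I. Poly_Mapping.keys (c i)"
  have S: "finite ?S" using assms by simp
  have "Poly_Mapping.keys (\<Sum>i\<in>I. frag_cmul (a i) (c i)) \<subseteq> ?S"
    by (rule order_trans[OF keys_sum]) auto
  then have "pairing w (\<Sum>i\<in>I. frag_cmul (a i) (c i)) d =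
      (\<Sum>x\<in>?S. \<Sum>i\<in>I. a i * (of_nat (w x) * Poly_Mapping.lookup (c i) x * Poly_Mapping.lookup d x))"
    by (simp add: pairing_superset[OF S] lookup_sum sum_distrib_left sum_distrib_right mult_ac)
  also have "\<dots> = (\<Sum>i\<in>I. a i * (\<Sum>x\<in>?S. of_nat (w x) * Poly_Mapping.lookup (c i) x * Poly_Mapping.lookup d x))"
    by (subst sum.swap) (simp add: sum_distrib_left)
  also have "\<dots> = (\<Sum>i\<in>I. a i * pairing w (c i) d)"
  proof (rule sum.cong)
    fix i assume "i \<in> I"
    then have "Poly_Mapping.keys (c i) \<subseteq> ?S" by blast
    then show "a i * (\<Sum>x\<in>?S. of_nat (w x) * Poly_Mapping.lookup (c i) x * Poly_Mapping.lookup d x) =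
        a i * pairing w (c i) d"
      by (simp only: pairing_superset[OF S])
  qed simp
  finally show ?thesis .
qed

lemma pairing_commute:
  fixes c d :: "'x \<Rightarrow>\<^sub>0 'r::comm_ring_1"
  shows "pairing w c d = pairing w d c"
  by (simp add: pairing_superset[of "Poly_Mapping.keys c \<union> Poly_Mapping.keys d"] mult_ac)

lemma gram_eq_fmat: "gram we \<phi> = fmat \<phi> \<phi> (pairing we)"
  by (simp add: gram_def fmat_def)

lemma int_basis_expand:
  assumes "int_basis M \<psi>" and "x \<in> M"
  obtains a where "x = (\<Sum>y\<in>set \<psi>. frag_cmul (a y) y)"
  using assms by (auto simp: int_basis_def Modules.module.span_finite[OF module_frag_cmul])

lemma int_basis_coeffs_unique:
  assumes "int_basis M \<phi>"
    and "(\<Sum>y\<in>set \<phi>. frag_cmul (a y) y) = (\<Sum>y\<in>set \<phi>. frag_cmul (b y) y)"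
    and "x \<in> set \<phi>"
  shows "a x = b x"
proof -
  have "(\<Sum>y\<in>set \<phi>. frag_cmul (a y - b y) y) = 0"
    using assms(2) by (simp add: sum_subtractf frag_cmul_diff_distrib)
  then show ?thesis
    using assms(1,3) Modules.module.independentD[OF module_frag_cmul, of "set \<phi>" "set \<phi>" "\<lambda>y. a y - b y" x]
    by (simp add: int_basis_def)
qed

text \<open>Substituting one expansion into the other writes \<open>x\<close> in terms of its own
  basis, where coefficients are unique. Used in both directions, it makes the transition matrices
  mutually inverse.\<close>

lemma int_basis_transition:
  assumes \<phi>: "int_basis M \<phi>" and \<psi>: "int_basis M \<psi>"
    and a: "\<And>x. x \<in> set \<phi> \<Longrightarrow> x = (\<Sum>y\<in>set \<psi>. frag_cmul (a x y) y)"
    and b: "\<And>y. y \<in> set \<psi> \<Longrightarrow> y = (\<Sum>x\<in>set \<phi>. frag_cmul (b y x) x)"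
    and x: "x \<in> set \<phi>" "x' \<in> set \<phi>"
  shows "(\<Sum>y\<in>set \<psi>. a x y * b y x') = (if x = x' then 1 else 0)"
proof (rule int_basis_coeffs_unique[OF \<phi> _ x(2)])
  have "(\<Sum>z\<in>set \<phi>. frag_cmul (\<Sum>y\<in>set \<psi>. a x y * b y z) z) =
      (\<Sum>z\<in>set \<phi>. \<Sum>y\<in>set \<psi>. frag_cmul (a x y) (frag_cmul (b y z) z))"
    by (intro sum.cong) (simp_all add: Modules.module.scale_sum_left[OF module_frag_cmul])
  also have "\<dots> = (\<Sum>y\<in>set \<psi>. frag_cmul (a x y) (\<Sum>z\<in>set \<phi>. frag_cmul (b y z) z))"
    by (subst sum.swap) (simp add: Modules.module.scale_sum_right[OF module_frag_cmul])
  also have "\<dots> = (\<Sum>y\<in>set \<psi>. frag_cmul (a x y) y)"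
    by (intro sum.cong refl arg_cong2[where f = frag_cmul] b[symmetric])
  also have "\<dots> = x" by (rule a[OF x(1), symmetric])
  also have "\<dots> = (\<Sum>z\<in>set \<phi>. if x = z then z else 0)" using x(1) by simp
  also have "\<dots> = (\<Sum>z\<in>set \<phi>. frag_cmul (if x = z then 1 else 0) z)"
    by (intro sum.cong) auto
  finally show "(\<Sum>z\<in>set \<phi>. frag_cmul (\<Sum>y\<in>set \<psi>. a x y * b y z) z) =
      (\<Sum>z\<in>set \<phi>. frag_cmul (if x = z then 1 else 0) z)" .
qed

text \<open>A change of basis replaces the Gram matrix by
  \<open>A * gram w \<psi> * transpose_mat A\<close> with \<open>A\<close> invertible over the
  integers, so its determinant is multiplied by the square of a unit. Hence the discriminant is well
  defined.\<close>

lemma det_gram_int_basis: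
  assumes \<phi>: "int_basis M \<phi>" and \<psi>: "int_basis M \<psi>"
  shows "Determinant.det (gram w \<phi>) = Determinant.det (gram w \<psi>)"
proof -
  have M: "set \<phi> \<subseteq> M" "set \<psi> \<subseteq> M" and d: "distinct \<phi>" "distinct \<psi>"
    using \<phi> \<psi> Modules.module.span_superset[OF module_frag_cmul] by (auto simp: int_basis_def)
  have "\<exists>a. x = (\<Sum>y\<in>set \<psi>. frag_cmul (a y) y)" if "x \<in> set \<phi>" for x
    using int_basis_expand[OF \<psi>, of x] that M by blast
  then obtain a where a: "\<And>x. x \<in> set \<phi> \<Longrightarrow> x = (\<Sum>y\<in>set \<psi>. frag_cmul (a x y) y)"
    by metis
  have "\<exists>b. y = (\<Sum>x\<in>set \<phi>. frag_cmul (b x) x)" if "y \<in> set \<psi>" for y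
    using int_basis_expand[OF \<phi>, of y] that M by blast
  then obtain b where b: "\<And>y. y \<in> set \<psi> \<Longrightarrow> y = (\<Sum>x\<in>set \<phi>. frag_cmul (b y x) x)"
    by metis
  note ab = int_basis_transition[OF \<phi> \<psi> a b] and ba = int_basis_transition[OF \<psi> \<phi> b a]
  \<comment> \<open>the transition matrices are mutually inverse, so comparing traces shows that they are square\<close>
  have "int (length \<phi>) = (\<Sum>x\<in>set \<phi>. \<Sum>y\<in>set \<psi>. a x y * b y x)"
    using d by (simp add: ab distinct_card)
  also have "\<dots> = (\<Sum>y\<in>set \<psi>. \<Sum>x\<in>set \<phi>. b y x * a x y)"
    by (subst sum.swap) (simp add: mult.commute)
  also have "\<dots> = int (length \<psi>)"
    using d by (simp add: ba distinct_card)
  finally have len: "length \<phi> = length \<psi>" by simp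
  let ?n = "length \<psi>"
  let ?A = "fmat \<phi> \<psi> a" and ?B = "fmat \<psi> \<phi> b"
  have A: "?A \<in> carrier_mat ?n ?n" and B: "?B \<in> carrier_mat ?n ?n"
    and G: "gram w \<psi> \<in> carrier_mat ?n ?n"
    using fmat_carrier[of \<phi> \<psi> a] fmat_carrier[of \<psi> \<phi> b] by (simp_all add: len gram_eq_fmat)
  have "?A * ?B = fmat \<phi> \<phi> (\<lambda>x x'. if x = x' then 1 else 0)"
    using d by (auto simp: fmat_mult ab intro!: fmat_cong)
  then have "?A * ?B = 1\<^sub>m ?n"
    using d by (simp add: fmat_one len)
  then have "Determinant.det ?A * Determinant.det ?B = 1"
    using det_mult[OF A B] by simp
  \<comment> \<open>The only integer units are 1 and -1, both with square 1.\<close>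
  then have detA: "Determinant.det ?A * Determinant.det ?A = 1"
    using zmult_eq_1_iff by auto
  have "gram w \<phi> = fmat \<phi> \<phi> (\<lambda>x x'. \<Sum>y'\<in>set \<psi>. (\<Sum>y\<in>set \<psi>. a x y * pairing w y y') * a x' y')"
    unfolding gram_eq_fmat
  proof (rule fmat_cong)
    fix x x' assume x: "x \<in> set \<phi>" "x' \<in> set \<phi>"
    have "pairing w x x' = (\<Sum>y\<in>set \<psi>. a x y * pairing w y x')"
      by (subst a[OF x(1)]) (simp add: pairing_sum_left)
    also have "\<dots> = (\<Sum>y\<in>set \<psi>. \<Sum>y'\<in>set \<psi>. a x y * pairing w y y' * a x' y')"
    proof (rule sum.cong)
      fix y
      have "pairing w y x' = pairing w x' y" by (rule pairing_commute)
      also have "\<dots> = (\<Sum>y'\<in>set \<psi>. a x' y' * pairing w y' y)"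
        by (subst a[OF x(2)]) (simp add: pairing_sum_left)
      finally show "a x y * pairing w y x' = (\<Sum>y'\<in>set \<psi>. a x y * pairing w y y' * a x' y')"
        by (simp add: sum_distrib_left mult_ac pairing_commute[of w y])
    qed simp
    also have "\<dots> = (\<Sum>y'\<in>set \<psi>. (\<Sum>y\<in>set \<psi>. a x y * pairing w y y') * a x' y')"
      by (subst sum.swap) (simp add: sum_distrib_right)
    finally show "pairing w x x' = (\<Sum>y'\<in>set \<psi>. (\<Sum>y\<in>set \<psi>. a x y * pairing w y y') * a x' y')" .
  qed
  also have "\<dots> = ?A * gram w \<psi> * transpose_mat ?A"
    using d by (simp add: gram_eq_fmat fmat_transpose fmat_mult)
  finally show ?thesis
    using A G detA by (simp add: det_mult[of _ ?n] det_transpose[OF A] mult_ac)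
qed

section \<open>Fundamental cycles of a spanning tree\<close>

lemma chains_iff: "c \<in> chains S \<longleftrightarrow> (\<forall>x. x \<notin> S \<longrightarrow> Poly_Mapping.lookup c x = 0)"
  by (auto simp: chains_def in_keys_iff)

definition incidence :: "('a, 'b) pre_digraph \<Rightarrow> 'a \<Rightarrow> 'b \<Rightarrow> 'r::comm_ring_1" where
  "incidence G v e = (if head G e = v then 1 else 0) - (if tail G e = v then 1 else 0)"

lemma lookup_boundary:
  assumes "finite S" "Poly_Mapping.keys c \<subseteq> S"
  shows "Poly_Mapping.lookup (boundary G c) v = (\<Sum>e\<in>S. incidence G v e * Poly_Mapping.lookup c e)"
  unfolding boundary_superset[OF assms] lookup_sum
  by (intro sum.cong) (auto simp: incidence_def lookup_minus lookup_single when_def)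

lemma boundary_diff: "boundary G (c - d) = boundary G c - boundary G d"
  using boundary_add[of G "c - d" d] by simp

lemma boundary_single:
  "boundary G (Poly_Mapping.single e a) = Poly_Mapping.single (head G e) a - Poly_Mapping.single (tail G e) a"
  by (simp add: boundary_superset[of "{e}"])

lemma chains_add: "c \<in> chains S \<Longrightarrow> d \<in> chains S \<Longrightarrow> c + d \<in> chains S"
  using Poly_Mapping.keys_add[of c d] by (auto simp: chains_def)

lemma chains_diff:
  fixes c d :: "'x \<Rightarrow>\<^sub>0 'r::ab_group_add"
  shows "c \<in> chains S \<Longrightarrow> d \<in> chains S \<Longrightarrow> c - d \<in> chains S"
  using keys_diff[of c d] by (auto simp: chains_def)

lemma of_int_incidence [simp]: "of_int (incidence G v e) = incidence G v e"
  by (simp add: incidence_def)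

lemma boundary_frag_cmul: "boundary G (frag_cmul k c) = frag_cmul k (boundary G c)"
  by (rule poly_mapping_eqI)
    (simp add: lookup_boundary[of "Poly_Mapping.keys c"] keys_cmul sum_distrib_left mult_ac)

lemma H1_subspace: "Modules.module.subspace frag_cmul (H1 G Ep)"
  unfolding Modules.module.subspace_def[OF module_frag_cmul]
  by (auto simp: H1_def boundary_add boundary_frag_cmul intro: chains_add)
    (auto simp: chains_def boundary_def)

text \<open>The entries of \<open>L = D W D\<^sup>T\<close>. Vertex weights are left out, so that
  this matrix is symmetric and they can be split off as a diagonal factor.\<close>

definition edge_form :: "('a, 'b) pre_digraph \<Rightarrow> 'b set \<Rightarrow> ('b \<Rightarrow> nat) \<Rightarrow> 'a \<Rightarrow> 'a \<Rightarrow> real" where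
  "edge_form G Ep we u v = (\<Sum>e\<in>Ep. incidence G u e * incidence G v e / real (we e))"

section \<open>Connectedness and growth of a spanning tree\<close>

context weighted_graph
begin

lemma finite_Ep: "finite Ep"
  using Ep_arcs finite_arcs finite_subset by blast

lemma head_neq_tail: "e \<in> Ep \<Longrightarrow> head G e \<noteq> tail G e"
  using Ep_arcs no_loops by fastforce

lemma Ep_ends: "e \<in> Ep \<Longrightarrow> head G e \<in> verts G" "e \<in> Ep \<Longrightarrow> tail G e \<in> verts G"
  using Ep_arcs by auto

text \<open>Connectedness in the form of cuts: if no edge crossed, everything reachable from
  \<open>u\<close> would lie in \<open>U\<close>. The conclusion is symmetric in the two ends
  because only one arc of each pair belongs to \<open>Ep\<close>.\<close>

lemma arc_leaving:
  assumes "u \<in> U" "v \<in> verts G - U" "u \<in> verts G"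
  obtains e where "e \<in> Ep" "head G e \<in> U \<longleftrightarrow> tail G e \<notin> U"
proof (rule ccontr)
  assume "\<not> thesis"
  with that have closed: "head G e \<in> U \<longleftrightarrow> tail G e \<in> U" if "e \<in> Ep" for e
    using \<open>e \<in> Ep\<close> by blast
  have "u \<rightarrow>\<^sup>*\<^bsub>G\<^esub> v"
    using symmetric_connected_imp_strongly_connected[OF sym_arcs conn] assms
    by (auto simp: strongly_connected_def)
  then have "v \<in> U"
  proof (induction rule: reachable_induct)
    case base
    show ?case by (rule assms(1))
  next
    case (step x y)
    then obtain e where e: "e \<in> arcs G" "tail G e = x" "head G e = y"
      by (auto simp: arcs_ends_def arc_to_ends_def)
    show ?case
    proof (cases "e \<in> Ep")
      case True
      then show ?thesis using closed[of e] e step by simp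
    next
      case False
      then show ?thesis using closed[OF arev_Ep[OF e(1)]] e step by simp
    qed
  qed
  with assms show False by simp
qed

text \<open>
  \<open>\<sigma> v\<close> is the chain of the tree path from \<open>r\<close> to \<open>v\<close>; the last clause says that \<open>T\<close> contains
  no cycle.
\<close>

definition rooted_tree :: "'a \<Rightarrow> 'a set \<Rightarrow> 'b set \<Rightarrow> ('a \<Rightarrow> 'b \<Rightarrow>\<^sub>0 int) \<Rightarrow> bool" where
  "rooted_tree r U T \<sigma> \<longleftrightarrow>
    U \<subseteq> verts G \<and> r \<in> U \<and> T \<subseteq> Ep \<and> card U = Suc (card T) \<and>
    (\<forall>e\<in>T. head G e \<in> U \<and> tail G e \<in> U) \<and>
    (\<forall>v\<in>U. \<sigma> v \<in> chains T \<and>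
      boundary G (\<sigma> v) = Poly_Mapping.single v 1 - Poly_Mapping.single r 1) \<and>
    (\<forall>c\<in>chains T. boundary G c = 0 \<longrightarrow> c = (0 :: 'b \<Rightarrow>\<^sub>0 int))"

text \<open>An edge crossing the cut at \<open>U\<close> has exactly one new end \<open>x\<close>.
  The path to \<open>x\<close> is the path to the old end followed by this edge, taken with a sign.
  No other tree edge meets \<open>x\<close>, so a cycle has coefficient 0 on the new edge and
  already lives on the old tree.\<close>

lemma rooted_tree_extend:
  assumes tree: "rooted_tree r U T \<sigma>" and "U \<noteq> verts G"
  shows "\<exists>U' T' \<sigma>'. rooted_tree r U' T' \<sigma>' \<and> card U' = Suc (card U)"
proof -
  from tree have U: "U \<subseteq> verts G" "r \<in> U" "card U = Suc (card T)"
    and T: "T \<subseteq> Ep" "\<And>e. e \<in> T \<Longrightarrow> head G e \<in> U \<and> tail G e \<in> U"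
    and \<sigma>: "\<And>v. v \<in> U \<Longrightarrow> \<sigma> v \<in> chains T \<and>
      boundary G (\<sigma> v) = Poly_Mapping.single v 1 - Poly_Mapping.single r 1"
    and inj: "\<And>c :: 'b \<Rightarrow>\<^sub>0 int. c \<in> chains T \<Longrightarrow> boundary G c = 0 \<Longrightarrow> c = 0"
    unfolding rooted_tree_def by blast+
  have finU: "finite U" and finT: "finite T"
    using U(1) T(1) finite_verts finite_Ep finite_subset by blast+
  obtain v where "v \<in> verts G - U" using U(1) assms(2) by blast
  then obtain e where e: "e \<in> Ep" "head G e \<in> U \<longleftrightarrow> tail G e \<notin> U"
    using arc_leaving[of r U v] U by blast
  have boundary_neg: "boundary G (Poly_Mapping.single e (-1)) =
      Poly_Mapping.single (tail G e) 1 - Poly_Mapping.single (head G e) (1::int)"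
    by (subst boundary_single) (simp add: single_uminus)
  \<comment> \<open>Here \<open>u\<close> is the old end and \<open>x\<close> the new one; the sign
    \<open>s\<close> makes \<open>e\<close> run from \<open>u\<close> to \<open>x\<close>.\<close>
  obtain u x s where ux: "u \<in> U" "x \<in> verts G" "x \<notin> U" "s = 1 \<or> s = -1"
    "boundary G (Poly_Mapping.single e s) = Poly_Mapping.single x 1 - Poly_Mapping.single u (1::int)"
    "(x = head G e \<and> u = tail G e) \<or> (x = tail G e \<and> u = head G e)"
  proof (cases "head G e \<in> U")
    case True
    show thesis
      by (rule that[of "head G e" "tail G e" "-1"])
        (use True e Ep_ends boundary_neg in auto)
  next
    case False
    show thesis
      by (rule that[of "tail G e" "head G e" 1])
        (use False e Ep_ends in \<open>auto simp: boundary_single\<close>)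
  qed
  have eT: "e \<notin> T" using T(2) e by blast
  let ?\<sigma> = "\<sigma>(x := \<sigma> u + Poly_Mapping.single e s)"
  have mono: "chains T \<subseteq> chains (insert e T)" by (auto simp: chains_def)
  have "Poly_Mapping.single e s \<in> chains (insert e T)" by (auto simp: chains_def)
  then have "?\<sigma> v \<in> chains (insert e T) \<and>
      boundary G (?\<sigma> v) = Poly_Mapping.single v 1 - Poly_Mapping.single r (1::int)"
    if "v \<in> insert x U" for v
    using that \<sigma> ux mono by (auto simp: boundary_add intro!: chains_add)
  moreover have "c = 0" if c: "c \<in> chains (insert e T)" "boundary G c = 0" for c :: "'b \<Rightarrow>\<^sub>0 int"
  proof -
    \<comment> \<open>The boundary is evaluated at the new vertex, where only \<open>e\<close>
      contributes.\<close>
    have "0 = (\<Sum>a\<in>insert e T. incidence G x a * Poly_Mapping.lookup c a)"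
      using c finT lookup_boundary[of "insert e T" c G x] by (simp add: chains_def)
    also have "\<dots> = incidence G x e * Poly_Mapping.lookup c e"
      using eT finT T(2) ux(3) by (auto simp: incidence_def intro!: sum.neutral)
    finally have "Poly_Mapping.lookup c e = 0"
      using ux(6) head_neq_tail[OF e(1)] by (auto simp: incidence_def)
    then have "c \<in> chains T" using c(1) by (auto simp: chains_def in_keys_iff)
    then show ?thesis using inj c(2) by blast
  qed
  ultimately have "rooted_tree r (insert x U) (insert e T) ?\<sigma>"
    unfolding rooted_tree_def
  proof (intro conjI ballI impI)
    show "insert x U \<subseteq> verts G" "r \<in> insert x U" "insert e T \<subseteq> Ep" using U T e ux(2) by auto
    show "card (insert x U) = Suc (card (insert e T))" using U(3) ux(3) eT finU finT by simp
    show "head G a \<in> insert x U" "tail G a \<in> insert x U" if "a \<in> insert e T" for a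
      using that T(2) ux(1,6) by auto
  qed auto
  moreover have "card (insert x U) = Suc (card U)" using ux(3) finU by simp
  ultimately show ?thesis by blast
qed

lemma spanning_tree:
  assumes r: "r \<in> verts G"
  obtains T \<sigma> where "rooted_tree r (verts G) T \<sigma>"
proof -
  \<comment> \<open>The root alone is a tree, and extension by one vertex at a time reaches every
    size up to the number of vertices.\<close>
  have "k < card (verts G) \<Longrightarrow> \<exists>U T \<sigma>. rooted_tree r U T \<sigma> \<and> card U = Suc k" for k
  proof (induction k)
    case 0
    have "rooted_tree r {r} {} (\<lambda>_. 0)"
      using r by (auto simp: rooted_tree_def chains_def boundary_def)
    then show ?case by force
  next
    case (Suc k)
    then obtain U T \<sigma> where "rooted_tree r U T \<sigma>" "card U = Suc k" by auto
    then show ?case using rooted_tree_extend[of r U T \<sigma>] Suc.prems by force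
  qed
  from this[of "card (verts G) - 1"] obtain U T \<sigma>
    where tree: "rooted_tree r U T \<sigma>" "card U = card (verts G)"
    using r card_gt_0_iff[of "verts G"] by auto
  moreover have "U \<subseteq> verts G" using tree by (simp add: rooted_tree_def)
  ultimately have "U = verts G" by (simp add: card_subset_eq)
  with tree that show thesis by blast
qed

text \<open>The edge \<open>f\<close> is closed up by the tree path from its head back to its tail,
  written as a difference of two paths from the root.\<close>

definition fund_cycle :: "('a \<Rightarrow> 'b \<Rightarrow>\<^sub>0 int) \<Rightarrow> 'b \<Rightarrow> 'b \<Rightarrow>\<^sub>0 int" where
  "fund_cycle \<sigma> f = Poly_Mapping.single f 1 - (\<sigma> (head G f) - \<sigma> (tail G f))"

section \<open>Cycle basis and Gram determinant for a fixed spanning tree\<close>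

context
  fixes r T \<sigma>
  assumes tree: "rooted_tree r (verts G) T \<sigma>"
begin

lemma tree_props:
  fixes c :: "'b \<Rightarrow>\<^sub>0 int"
  shows "T \<subseteq> Ep" "card (verts G) = Suc (card T)" "r \<in> verts G"
    and "v \<in> verts G \<Longrightarrow> \<sigma> v \<in> chains T"
    and "v \<in> verts G \<Longrightarrow> boundary G (\<sigma> v) = Poly_Mapping.single v 1 - Poly_Mapping.single r 1"
    and "c \<in> chains T \<Longrightarrow> boundary G c = 0 \<Longrightarrow> c = 0"
  using tree by (auto simp: rooted_tree_def)

lemma fund_cycle_H1: "f \<in> Ep \<Longrightarrow> fund_cycle \<sigma> f \<in> H1 G Ep"
proof -
  assume f: "f \<in> Ep"
  have "\<sigma> v \<in> chains Ep" if "v \<in> verts G" for v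
    using tree_props(1,4) that by (force simp: chains_def)
  then have "fund_cycle \<sigma> f \<in> chains Ep"
    unfolding fund_cycle_def using f Ep_ends[OF f]
    by (intro chains_diff) (auto simp: chains_def)
  then show ?thesis
    using Ep_ends[OF f] by (simp add: H1_def fund_cycle_def boundary_diff boundary_single tree_props(5))
qed

text \<open>Tree paths do not leave \<open>T\<close>, so off the tree only the edge \<open>f\<close>
  itself remains. The coefficients off the tree thus serve as coordinates on cycles.\<close>

lemma lookup_fund_cycle:
  assumes "f \<in> Ep" "e \<notin> T"
  shows "Poly_Mapping.lookup (fund_cycle \<sigma> f) e = (if e = f then 1 else 0)"
proof -
  have "Poly_Mapping.lookup (\<sigma> v) e = 0" if "v \<in> verts G" for v
    using tree_props(4)[OF that] assms(2) by (auto simp: chains_def in_keys_iff)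
  then show ?thesis
    using Ep_ends[OF assms(1)] by (auto simp: fund_cycle_def lookup_minus lookup_single when_def)
qed

lemma lookup_sum_fund_cycle:
  assumes "e \<in> Ep - T"
  shows "Poly_Mapping.lookup (\<Sum>f\<in>Ep - T. frag_cmul (a f) (fund_cycle \<sigma> f)) e = a e"
proof -
  have "Poly_Mapping.lookup (\<Sum>f\<in>Ep - T. frag_cmul (a f) (fund_cycle \<sigma> f)) e =
      (\<Sum>f\<in>Ep - T. if e = f then a e else 0)"
    unfolding lookup_sum using assms by (intro sum.cong) (auto simp: lookup_fund_cycle)
  also have "\<dots> = a e" using assms finite_Ep by simp
  finally show ?thesis .
qed

text \<open>Subtracting the combination with the same coefficients off the tree leaves a cycle
  supported on \<open>T\<close>, and a tree carries no nonzero cycle.\<close>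

lemma cycle_expand:
  assumes c: "c \<in> H1 G Ep"
  shows "c = (\<Sum>f\<in>Ep - T. frag_cmul (Poly_Mapping.lookup c f) (fund_cycle \<sigma> f))"
proof -
  let ?s = "\<Sum>f\<in>Ep - T. frag_cmul (Poly_Mapping.lookup c f) (fund_cycle \<sigma> f)"
  have "?s \<in> H1 G Ep"
    by (intro Modules.module.subspace_sum[OF module_frag_cmul H1_subspace]
        Modules.module.subspace_scale[OF module_frag_cmul H1_subspace] fund_cycle_H1) auto
  then have d: "c - ?s \<in> H1 G Ep"
    by (rule Modules.module.subspace_diff[OF module_frag_cmul H1_subspace c])
  have "Poly_Mapping.lookup (c - ?s) e = 0" if "e \<notin> T" for e
  proof (cases "e \<in> Ep")
    case True
    then show ?thesis using that lookup_sum_fund_cycle[of e "Poly_Mapping.lookup c"] by (simp add: lookup_minus)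
  next
    case False
    then show ?thesis using d by (auto simp: H1_def chains_def in_keys_iff)
  qed
  then have "c - ?s \<in> chains T" by (auto simp: chains_def in_keys_iff)
  then have "c - ?s = 0" by (rule tree_props(6)) (use d in \<open>simp add: H1_def\<close>)
  then show ?thesis by (simp only: right_minus_eq)
qed

lemma fund_cycle_basis:
  assumes ns: "distinct ns" "set ns = Ep - T"
  shows "int_basis (H1 G Ep) (map (fund_cycle \<sigma>) ns)"
proof -
  have inj: "inj_on (fund_cycle \<sigma>) (Ep - T)"
  proof (rule inj_onI)
    fix f g assume "f \<in> Ep - T" "g \<in> Ep - T" "fund_cycle \<sigma> f = fund_cycle \<sigma> g"
    then show "f = g"
      using lookup_fund_cycle[of f f] lookup_fund_cycle[of g f] by (auto split: if_splits)
  qed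
  have fin: "finite (fund_cycle \<sigma> ` (Ep - T))" using finite_Ep by simp
  have "\<not> Modules.module.dependent frag_cmul (fund_cycle \<sigma> ` (Ep - T))"
    unfolding Modules.module.dependent_finite[OF module_frag_cmul fin]
  proof (intro notI, elim exE conjE bexE)
    fix u c assume sum: "(\<Sum>v\<in>fund_cycle \<sigma> ` (Ep - T). frag_cmul (u v) v) = 0"
      and c: "c \<in> fund_cycle \<sigma> ` (Ep - T)" "u c \<noteq> 0"
    then obtain f where f: "f \<in> Ep - T" "c = fund_cycle \<sigma> f" by blast
    have "u (fund_cycle \<sigma> f) = Poly_Mapping.lookup (\<Sum>f\<in>Ep - T. frag_cmul (u (fund_cycle \<sigma> f)) (fund_cycle \<sigma> f)) f"
      by (rule lookup_sum_fund_cycle[OF f(1), symmetric])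
    also have "\<dots> = 0" using sum by (simp add: sum.reindex[OF inj])
    finally show False using f c by simp
  qed
  moreover have "Modules.module.span frag_cmul (fund_cycle \<sigma> ` (Ep - T)) = H1 G Ep"
  proof
    show "Modules.module.span frag_cmul (fund_cycle \<sigma> ` (Ep - T)) \<subseteq> H1 G Ep"
      by (rule Modules.module.span_minimal[OF module_frag_cmul _ H1_subspace])
        (auto intro: fund_cycle_H1)
    show "H1 G Ep \<subseteq> Modules.module.span frag_cmul (fund_cycle \<sigma> ` (Ep - T))"
    proof
      fix c assume c: "c \<in> H1 G Ep"
      show "c \<in> Modules.module.span frag_cmul (fund_cycle \<sigma> ` (Ep - T))"
        by (subst cycle_expand[OF c])
          (intro Modules.module.span_sum[OF module_frag_cmul] Modules.module.span_scale[OF module_frag_cmul]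
            Modules.module.span_base[OF module_frag_cmul] imageI)
    qed
  qed
  ultimately show ?thesis
    using ns inj by (simp add: int_basis_def distinct_map)
qed

text \<open>The tree paths \<open>\<sigma> u\<close> form an integral inverse: the boundary of the
  path to \<open>v\<close> is \<open>v\<close> minus the root, and the row of the root is omitted.
  So the determinant is an integer unit.\<close>

lemma det_tree_incidence:
  assumes us: "distinct us" "set us = verts G - {r}" and ts: "distinct ts" "set ts = T"
  shows "Determinant.det (fmat us ts (incidence G :: 'a \<Rightarrow> 'b \<Rightarrow> real)) ^ 2 = 1"
proof -
  let ?n = "length ts"
  have len: "length us = ?n"
    using us ts tree_props(2,3) by (metis card_Diff_singleton diff_Suc_1 distinct_card)
  let ?D = "fmat us ts (incidence G :: 'a \<Rightarrow> 'b \<Rightarrow> int)"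
  let ?S = "fmat ts us (\<lambda>e u. Poly_Mapping.lookup (\<sigma> u) e)"
  have D: "?D \<in> carrier_mat ?n ?n" and S: "?S \<in> carrier_mat ?n ?n"
    using fmat_carrier[of us ts] fmat_carrier[of ts us] by (simp_all add: len)
  have "?D * ?S = fmat us us (\<lambda>u v. if u = v then 1 else 0)"
    unfolding fmat_mult[OF ts(1)]
  proof (rule fmat_cong)
    fix u v assume uv: "u \<in> set us" "v \<in> set us"
    have "(\<Sum>e\<in>set ts. incidence G u e * Poly_Mapping.lookup (\<sigma> v) e) = Poly_Mapping.lookup (boundary G (\<sigma> v)) u"
      using uv us ts tree_props(4) by (subst lookup_boundary[of T]) (auto simp: chains_def)
    also have "\<dots> = (if u = v then 1 else 0)"
      using uv us by (auto simp: tree_props(5) lookup_minus lookup_single when_def)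
    finally show "(\<Sum>e\<in>set ts. incidence G u e * Poly_Mapping.lookup (\<sigma> v) e) = (if u = v then 1 else 0)" .
  qed
  then have "?D * ?S = 1\<^sub>m ?n" using us by (simp add: fmat_one len)
  then have "Determinant.det ?D * Determinant.det ?S = 1" using det_mult[OF D S] by simp
  then have "Determinant.det ?D ^ 2 = 1" using zmult_eq_1_iff by fastforce
  moreover have "Determinant.det (fmat us ts (incidence G :: 'a \<Rightarrow> 'b \<Rightarrow> real)) = of_int (Determinant.det ?D)"
    by (simp flip: of_int_hom.hom_det add: map_mat_fmat)
  ultimately show ?thesis by (metis of_int_1 of_int_power)
qed

text \<open>Separating edges off and on the tree writes the Gram matrix as
  \<open>?X + ?B * ?Y * ?C\<close>, with \<open>?C\<close> the tree coefficients of the fundamental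
  cycles and \<open>?B\<close> its transpose. Sylvester's identity extracts all edge weights and
  leaves a determinant indexed by tree edges; conjugating it with the unimodular block
  \<open>?D\<close> yields the reduced matrix of \<open>edge_form\<close>.\<close>

lemma det_gram_fund_cycle:
  assumes ns: "distinct ns" "set ns = Ep - T" and us: "distinct us" "set us = verts G - {r}"
  shows "real_of_int (Determinant.det (gram we (map (fund_cycle \<sigma>) ns))) =
    (\<Prod>e\<in>Ep. real (we e)) * Determinant.det (fmat us us (edge_form G Ep we))"
proof -
  have finT: "finite T" using tree_props(1) finite_Ep finite_subset by blast
  then obtain ts where ts: "distinct ts" "set ts = T" using finite_distinct_list by blast
  have len: "length us = length ts"
    using us ts tree_props(2,3) by (metis card_Diff_singleton diff_Suc_1 distinct_card)
  have w: "we e \<noteq> 0" if "e \<in> Ep" for e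
    using that Ep_arcs we_pos by fastforce
  define F where "F e f = real_of_int (Poly_Mapping.lookup (fund_cycle \<sigma> f) e)" for e f
  let ?diag = "\<lambda>xs w. fmat xs xs (\<lambda>x y. if x = y then w x else 0)"
  let ?X = "?diag ns (\<lambda>e. real (we e))" and ?X' = "?diag ns (\<lambda>e. 1 / real (we e))"
  let ?Y = "?diag ts (\<lambda>e. real (we e))" and ?Y' = "?diag ts (\<lambda>e. 1 / real (we e))"
  let ?B = "fmat ns ts (\<lambda>f e. F e f)" and ?C = "fmat ts ns F"
  let ?D = "fmat us ts (incidence G :: 'a \<Rightarrow> 'b \<Rightarrow> real)"
  have split: "(\<Sum>e\<in>Ep. h e) = (\<Sum>e\<in>Ep - T. h e) + (\<Sum>e\<in>T. h e)" for h :: "'b \<Rightarrow> real"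
    using finite_Ep tree_props(1) by (rule sum.subset_diff[rotated])
  have "real_of_int (pairing we (fund_cycle \<sigma> f) (fund_cycle \<sigma> g)) =
      (if f = g then real (we f) else 0) + (\<Sum>e\<in>T. F e f * real (we e) * F e g)"
    if "f \<in> Ep - T" "g \<in> Ep - T" for f g
  proof -
    have "Poly_Mapping.keys (fund_cycle \<sigma> f) \<subseteq> Ep"
      using fund_cycle_H1[of f] that by (auto simp: H1_def chains_def)
    then have "real_of_int (pairing we (fund_cycle \<sigma> f) (fund_cycle \<sigma> g)) =
        (\<Sum>e\<in>Ep. real (we e) * F e f * F e g)"
      by (simp add: pairing_superset[OF finite_Ep] F_def)
    moreover have "(\<Sum>e\<in>Ep - T. real (we e) * F e f * F e g) =
        (\<Sum>e\<in>Ep - T. if e = f then (if f = g then real (we f) else 0) else 0)"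
      using that by (intro sum.cong) (auto simp: F_def lookup_fund_cycle)
    ultimately show ?thesis
      using that finite_Ep by (simp add: split mult_ac)
  qed
  then have "map_mat real_of_int (gram we (map (fund_cycle \<sigma>) ns)) = ?X + ?B * ?Y * ?C"
    using ns ts by (simp add: gram_eq_fmat fmat_map map_mat_fmat fmat_mult_diag fmat_mult fmat_add)
      (intro fmat_cong, simp)
  then have "real_of_int (Determinant.det (gram we (map (fund_cycle \<sigma>) ns))) =
      Determinant.det (?X + ?B * ?Y * ?C)"
    by (metis of_int_hom.hom_det)
  also have "\<dots> = Determinant.det ?X * Determinant.det ?Y * Determinant.det (?Y' + ?C * ?X' * ?B)"
  proof (rule det_sylvester)
    have "f \<in> set ns \<Longrightarrow> we f \<noteq> 0" "f \<in> set ts \<Longrightarrow> we f \<noteq> 0" for f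
      using ns ts w tree_props(1) by blast+
    then show "?X * ?X' = 1\<^sub>m (length ns)" "?Y' * ?Y = 1\<^sub>m (length ts)"
      using ns(1) ts(1)
      by (simp_all add: fmat_mult_diag flip: fmat_one) (intro fmat_cong, fastforce)+
  qed auto
  also have "Determinant.det ?X * Determinant.det ?Y = (\<Prod>e\<in>Ep. real (we e))"
    using ns ts prod.subset_diff[OF tree_props(1) finite_Ep, of "\<lambda>e. real (we e)"] by (simp add: det_fmat_diag)
  also have "Determinant.det (?Y' + ?C * ?X' * ?B) = Determinant.det (fmat us us (edge_form G Ep we))"
  proof -
    let ?K = "?Y' + ?C * ?X' * ?B"
    \<comment> \<open>The boundary of a fundamental cycle vanishes, so its tree part has the
      boundary opposite to that of \<open>f\<close>.\<close>
    have inc: "(\<Sum>e\<in>T. incidence G u e * F e f) = - incidence G u f" if u: "u \<noteq> r" and f: "f \<in> Ep - T" for u f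
    proof -
      have "0 = real_of_int (Poly_Mapping.lookup (boundary G (fund_cycle \<sigma> f)) u)"
        using fund_cycle_H1[of f] f by (simp add: H1_def)
      also have "\<dots> = (\<Sum>e\<in>Ep. incidence G u e * F e f)"
        using fund_cycle_H1[of f] f finite_Ep
        by (subst lookup_boundary[of Ep]) (auto simp: H1_def chains_def F_def)
      also have "(\<Sum>e\<in>Ep - T. incidence G u e * F e f) = (\<Sum>e\<in>Ep - T. if e = f then incidence G u f else 0)"
        using f by (intro sum.cong) (auto simp: F_def lookup_fund_cycle)
      then have "(\<Sum>e\<in>Ep. incidence G u e * F e f) = incidence G u f + (\<Sum>e\<in>T. incidence G u e * F e f)"
        using f finite_Ep by (simp add: split)
      finally show ?thesis by simp
    qed
    have "?D * ?Y' = fmat us ts (\<lambda>u e. incidence G u e * (1 / real (we e)))"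
      using ts by (simp only: fmat_mult_diag)
    then have 1: "?D * ?Y' * transpose_mat ?D = fmat us us (\<lambda>u v. \<Sum>e\<in>T. incidence G u e * incidence G v e / real (we e))"
      using ts by (simp add: fmat_mult fmat_transpose)
    have 2: "?D * ?C = fmat us ns (\<lambda>u f. - incidence G u f)"
      unfolding fmat_mult[OF ts(1)] ts(2) using us ns by (intro fmat_cong inc) auto
    have 3: "?B * transpose_mat ?D = fmat ns us (\<lambda>f u. - incidence G u f)"
      unfolding fmat_transpose fmat_mult[OF ts(1)] ts(2) mult.commute[of "F _ _"]
      using us ns by (intro fmat_cong inc) auto
    have D: "?D \<in> carrier_mat (length ts) (length ts)"
      using fmat_carrier[of us ts] by (simp only: len)
    have K: "?K \<in> carrier_mat (length ts) (length ts)"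
      by (intro add_carrier_mat mult_carrier_mat[of _ _ "length ns"] fmat_carrier)
    have "?D * ?K * transpose_mat ?D =
        ?D * ?Y' * transpose_mat ?D + (?D * ?C) * ?X' * (?B * transpose_mat ?D)"
      unfolding fmat_transpose by (rule mat_mult_sum_sandwich; rule fmat_carrier)
    \<comment> \<open>The two minus signs cancel, and the sums over the tree and its complement join
      into one over \<open>Ep\<close>.\<close>
    also have "\<dots> = fmat us us (edge_form G Ep we)"
      unfolding 1 2 3 edge_form_def using ns by (simp add: fmat_mult_diag fmat_mult fmat_add split)
        (intro fmat_cong, simp add: add.commute)
    finally have "Determinant.det (fmat us us (edge_form G Ep we)) = Determinant.det (?D * ?K * transpose_mat ?D)"
      by simp
    also have "\<dots> = Determinant.det ?D ^ 2 * Determinant.det ?K"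
      using D K by (simp add: det_mult[of _ "length ts"] det_transpose[OF D] power2_eq_square)
    finally show ?thesis using det_tree_incidence[OF us ts] by simp
  qed
  finally show ?thesis .
qed

end

text \<open>The left side does not mention \<open>r\<close>: for every omitted vertex the reduced
  determinant is the same number.\<close>

lemma det_gram_H1:
  assumes \<phi>: "int_basis (H1 G Ep) \<phi>"
    and us: "distinct us" "set us = verts G - {r}" and r: "r \<in> verts G"
  shows "real_of_int (Determinant.det (gram we \<phi>)) =
    (\<Prod>e\<in>Ep. real (we e)) * Determinant.det (fmat us us (edge_form G Ep we))"
proof -
  obtain T \<sigma> where tree: "rooted_tree r (verts G) T \<sigma>" by (rule spanning_tree[OF r])
  obtain ns where ns: "distinct ns" "set ns = Ep - T"
    using finite_Ep finite_distinct_list[of "Ep - T"] by auto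
  have "Determinant.det (gram we \<phi>) = Determinant.det (gram we (map (fund_cycle \<sigma>) ns))"
    by (rule det_gram_int_basis[OF \<phi> fund_cycle_basis[OF tree ns]])
  then show ?thesis using det_gram_fund_cycle[OF tree ns us] by simp
qed

section \<open>The discriminant as a Gram determinant\<close>

lemma verts_nonempty: "verts G \<noteq> {}"
  using conn by (auto simp: connected_conv)

lemma H1_basis_exists: "\<exists>\<phi>. int_basis (H1 G Ep) \<phi>"
proof -
  obtain r where "r \<in> verts G" using verts_nonempty by blast
  then obtain T \<sigma> where tree: "rooted_tree r (verts G) T \<sigma>" by (rule spanning_tree)
  obtain ns where "distinct ns" "set ns = Ep - T"
    using finite_Ep finite_distinct_list[of "Ep - T"] by auto
  then show ?thesis using fund_cycle_basis[OF tree] by blast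
qed

lemma discriminant_eq:
  assumes "int_basis (H1 G Ep) \<phi>"
  shows "discriminant G Ep we = \<bar>Determinant.det (gram we \<phi>)\<bar>"
  unfolding discriminant_def
proof (rule the_equality)
  show "\<exists>\<psi>. int_basis (H1 G Ep) \<psi> \<and> \<bar>Determinant.det (gram we \<phi>)\<bar> = \<bar>Determinant.det (gram we \<psi>)\<bar>"
    using assms by blast
  show "d = \<bar>Determinant.det (gram we \<phi>)\<bar>"
    if "\<exists>\<psi>. int_basis (H1 G Ep) \<psi> \<and> d = \<bar>Determinant.det (gram we \<psi>)\<bar>" for d
    using that det_gram_int_basis[OF assms] by auto
qed

end

section \<open>The spectrum of the weighted Laplacian\<close>

lemma count_list_eq_card: "count_list xs x = card {i. i < length xs \<and> xs ! i = x}"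
  by (simp add: count_list_eq_length_filter length_filter_conv_card eq_commute)

context weighted_graph
begin

section \<open>The Laplacian in coordinates and its quadratic form\<close>

abbreviation cobd :: "('a \<Rightarrow>\<^sub>0 real) \<Rightarrow> 'b \<Rightarrow>\<^sub>0 real" where
  "cobd \<equiv> coboundary G arev Ep we wv"

abbreviation lap :: "('a \<Rightarrow>\<^sub>0 real) \<Rightarrow> 'a \<Rightarrow>\<^sub>0 real" where
  "lap \<equiv> laplacian G arev Ep we wv"

lemma lookup_coboundary_outside:
  assumes "e \<notin> Ep"
  shows "Poly_Mapping.lookup (cobd f) e = 0"
proof -
  have "Poly_Mapping.lookup (arc_chain arev Ep a :: 'b \<Rightarrow>\<^sub>0 real) e = 0" if "a \<in> arcs G" for a
    using assms arev_Ep[OF that] by (auto simp: arc_chain_def lookup_single when_def)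
  then show ?thesis
    by (auto simp: coboundary_def lookup_sum lookup_scaleR_real)
qed

lemma coboundary_chains: "cobd f \<in> chains Ep"
  using lookup_coboundary_outside[of _ f] by (auto simp: chains_iff)

lemma sum_incidence:
  fixes g :: "'a \<Rightarrow> real"
  assumes "e \<in> Ep"
  shows "(\<Sum>v\<in>verts G. incidence G v e * g v) = g (head G e) - g (tail G e)"
proof -
  have "(\<Sum>v\<in>verts G. incidence G v e * g v) =
      (\<Sum>v\<in>verts G. (if head G e = v then g v else 0) - (if tail G e = v then g v else 0))"
    by (intro sum.cong) (auto simp: incidence_def)
  then show ?thesis using Ep_ends[OF assms] by (simp add: sum_subtractf)
qed

text \<open>This is the factorization \<open>L V\<close> of the Laplacian in coordinates; one factor
  \<open>incidence\<close> comes from the boundary and the other from its adjoint.\<close>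

lemma lookup_laplacian:
  "Poly_Mapping.lookup (lap f) u =
    (\<Sum>v\<in>verts G. edge_form G Ep we u v * real (wv v) * Poly_Mapping.lookup f v)"
proof -
  let ?f = "\<lambda>v. real (wv v) * Poly_Mapping.lookup f v"
  have "Poly_Mapping.lookup (lap f) u = (\<Sum>e\<in>Ep. incidence G u e * Poly_Mapping.lookup (cobd f) e)"
    unfolding laplacian_def using coboundary_chains
    by (intro lookup_boundary finite_Ep) (auto simp: chains_def)
  also have "\<dots> = (\<Sum>e\<in>Ep. \<Sum>v\<in>verts G. incidence G u e * incidence G v e / real (we e) * ?f v)"
  proof (rule sum.cong)
    fix e assume e: "e \<in> Ep"
    have "incidence G u e * Poly_Mapping.lookup (cobd f) e =
        incidence G u e / real (we e) * (\<Sum>v\<in>verts G. incidence G v e * ?f v)"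
      unfolding lookup_coboundary[OF e] sum_incidence[OF e] by simp
    then show "incidence G u e * Poly_Mapping.lookup (cobd f) e =
        (\<Sum>v\<in>verts G. incidence G u e * incidence G v e / real (we e) * ?f v)"
      by (simp add: sum_distrib_left mult_ac)
  qed simp
  also have "\<dots> = (\<Sum>v\<in>verts G. edge_form G Ep we u v * ?f v)"
    by (subst sum.swap) (simp add: edge_form_def sum_distrib_right)
  finally show ?thesis by (simp add: mult.assoc)
qed

lemma laplacian_chains: "lap f \<in> chains (verts G)"
proof -
  have "edge_form G Ep we u v = 0" if "u \<notin> verts G" for u v
    unfolding edge_form_def incidence_def using that Ep_ends by (intro sum.neutral) auto
  then show ?thesis by (simp add: chains_iff lookup_laplacian)
qed

lemma chains_verts_eqI:
  assumes "f \<in> chains (verts G)" "g \<in> chains (verts G)"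
    and "\<And>v. v \<in> verts G \<Longrightarrow> Poly_Mapping.lookup f v = Poly_Mapping.lookup g v"
  shows "f = g"
proof (rule poly_mapping_eqI)
  fix v show "Poly_Mapping.lookup f v = Poly_Mapping.lookup g v"
    using assms by (cases "v \<in> verts G") (auto simp: chains_iff)
qed

text \<open>Adjointness turns the form into the square norm of the coboundary. This yields both the
  sign of the eigenvalues and the kernel.\<close>

lemma laplacian_form:
  assumes "f \<in> chains (verts G)"
  shows "pairing wv (lap f) f = (\<Sum>e\<in>Ep. real (we e) * (Poly_Mapping.lookup (cobd f) e)\<^sup>2)"
proof -
  have "pairing wv (lap f) f = pairing we (cobd f) (cobd f)"
    unfolding laplacian_def by (rule coboundary_adjoint[OF coboundary_chains assms, symmetric])
  also have "\<dots> = (\<Sum>e\<in>Ep. real (we e) * (Poly_Mapping.lookup (cobd f) e)\<^sup>2)"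
    using coboundary_chains[of f]
    by (simp add: pairing_superset[OF finite_Ep] chains_def power2_eq_square mult.assoc)
  finally show ?thesis .
qed

section \<open>Sign of the eigenvalues, kernel and eigenspaces\<close>

lemma eigenvalue_nonneg:
  assumes f: "f \<in> eigenspace G arev Ep we wv x" "f \<noteq> 0"
  shows "0 \<le> x"
proof -
  have ch: "f \<in> chains (verts G)" and eq: "lap f = x *\<^sub>R f"
    using f by (auto simp: eigenspace_def)
  let ?N = "\<Sum>v\<in>verts G. real (wv v) * (Poly_Mapping.lookup f v)\<^sup>2"
  have "pairing wv (lap f) f = x * ?N"
    using laplacian_chains[of f]
    by (simp add: eq pairing_superset[OF finite_verts] chains_def lookup_scaleR_real sum_distrib_left power2_eq_square mult_ac)
  moreover have "0 \<le> pairing wv (lap f) f"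
    unfolding laplacian_form[OF ch] by (intro sum_nonneg) simp
  moreover have "0 < ?N"
  proof -
    obtain v where "Poly_Mapping.lookup f v \<noteq> 0" using f(2) by (metis poly_mapping_eqI lookup_zero)
    moreover from this have "v \<in> verts G" using ch by (auto simp: chains_iff)
    ultimately show ?thesis using wv_pos by (intro sum_pos2[of _ v]) auto
  qed
  ultimately show ?thesis by (simp add: zero_le_mult_iff)
qed

text \<open>A chain in the kernel has zero coboundary, so vertex weight times coefficient agrees at
  the ends of each edge and, by connectedness, everywhere. Hence the reciprocal vertex weights span
  the kernel.\<close>

lemma dim_kernel: "dim (eigenspace G arev Ep we wv 0) = 1"
proof -
  define g :: "'a \<Rightarrow>\<^sub>0 real" where "g = (\<Sum>v\<in>verts G. Poly_Mapping.single v (1 / real (wv v)))"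
  have g: "Poly_Mapping.lookup g v = (if v \<in> verts G then 1 / real (wv v) else 0)" for v
    unfolding g_def lookup_sum lookup_single when_def by simp
  have g_chain: "g \<in> chains (verts G)" by (auto simp: chains_iff g split: if_splits)
  have wv0: "wv v \<noteq> 0" if "v \<in> verts G" for v using wv_pos[OF that] by simp
  obtain r where r: "r \<in> verts G" using verts_nonempty by blast
  show ?thesis
  proof (rule dim_unique[of "{g}"])
    have "Poly_Mapping.lookup (lap g) u = 0" for u
    proof -
      have "Poly_Mapping.lookup (lap g) u = (\<Sum>v\<in>verts G. edge_form G Ep we u v)"
        unfolding lookup_laplacian using wv0 by (intro sum.cong) (auto simp: g)
      also have "\<dots> = (\<Sum>e\<in>Ep. incidence G u e / real (we e) * (\<Sum>v\<in>verts G. incidence G v e * 1))"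
        unfolding edge_form_def by (subst sum.swap) (simp add: sum_distrib_left)
      also have "\<dots> = 0" by (intro sum.neutral ballI) (simp only: sum_incidence, simp)
      finally show ?thesis .
    qed
    then have "lap g = 0" by (intro poly_mapping_eqI) simp
    then show "{g} \<subseteq> eigenspace G arev Ep we wv 0" using g_chain by (simp add: eigenspace_def)
    show "eigenspace G arev Ep we wv 0 \<subseteq> span {g}"
    proof
      fix f assume "f \<in> eigenspace G arev Ep we wv 0"
      then have ch: "f \<in> chains (verts G)" and "lap f = 0" by (auto simp: eigenspace_def)
      then have "(\<Sum>e\<in>Ep. real (we e) * (Poly_Mapping.lookup (cobd f) e)\<^sup>2) = 0"
        using laplacian_form[OF ch] by (simp add: pairing_def)
      then have "\<forall>e\<in>Ep. real (we e) * (Poly_Mapping.lookup (cobd f) e)\<^sup>2 = 0"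
        by (subst (asm) sum_nonneg_eq_0_iff[OF finite_Ep]) auto
      then have const: "real (wv (head G e)) * Poly_Mapping.lookup f (head G e) =
          real (wv (tail G e)) * Poly_Mapping.lookup f (tail G e)" if "e \<in> Ep" for e
        using that Ep_arcs we_pos by (fastforce simp: lookup_coboundary)
      let ?c = "real (wv r) * Poly_Mapping.lookup f r"
      have "real (wv v) * Poly_Mapping.lookup f v = ?c" if v: "v \<in> verts G" for v
      proof (rule ccontr)
        assume "real (wv v) * Poly_Mapping.lookup f v \<noteq> ?c"
        \<comment> \<open>Some edge would leave the level set of \<open>?c\<close>, contradicting
          \<open>const\<close>.\<close>
        then obtain e where e: "e \<in> Ep"
          "head G e \<in> {u. real (wv u) * Poly_Mapping.lookup f u = ?c} \<longleftrightarrow>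
            tail G e \<notin> {u. real (wv u) * Poly_Mapping.lookup f u = ?c}"
          using arc_leaving[of r "{u. real (wv u) * Poly_Mapping.lookup f u = ?c}" v] v r by auto
        then show False using const[OF e(1)] by simp
      qed
      then have "f = ?c *\<^sub>R g"
        using wv0 ch g_chain
        by (intro poly_mapping_eqI) (auto simp: lookup_scaleR_real g chains_iff field_simps)
      then show "f \<in> span {g}" by (metis insertI1 span_base span_scale)
    qed
    have "Poly_Mapping.lookup g r \<noteq> 0" using r wv0 by (simp add: g)
    then have "g \<noteq> 0" by auto
    then show "independent {g}" by simp
  qed simp
qed

text \<open>The columns of \<open>P\<close> that belong to diagonal entries equal to
  \<open>x\<close> form a basis of the eigenspace; pairing with the rows of \<open>Q\<close> shows
  independence and spanning.\<close>

lemma dim_eigenspace: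
  assumes vs: "distinct vs" "set vs = verts G" and ds: "length ds = length vs"
    and wit: "similar_mat_wit (fmat vs vs (\<lambda>u v. edge_form G Ep we u v * real (wv v)))
      (mat (length vs) (length vs) (\<lambda>(i, j). if i = j then ds ! i else 0)) P Q"
  shows "dim (eigenspace G arev Ep we wv x) = count_list ds x"
proof -
  let ?n = "length vs"
  let ?M = "fmat vs vs (\<lambda>u v. edge_form G Ep we u v * real (wv v))"
  let ?D = "mat ?n ?n (\<lambda>(i, j). if i = j then ds ! i else 0)"
  have M: "?M \<in> carrier_mat ?n ?n" by simp
  note wit' = similar_mat_witD2[OF M wit]
  have P: "P \<in> carrier_mat ?n ?n" and Q: "Q \<in> carrier_mat ?n ?n" and D: "?D \<in> carrier_mat ?n ?n"
    using wit' by auto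
  have PQ: "(\<Sum>k<?n. P $$ (i, k) * Q $$ (k, j)) = (if i = j then 1 else 0)" if "i < ?n" "j < ?n" for i j
    using wit'(1) that by (simp flip: mat_mult_index_sum[OF P Q])
  have QP: "(\<Sum>k<?n. Q $$ (i, k) * P $$ (k, j)) = (if i = j then 1 else 0)" if "i < ?n" "j < ?n" for i j
    using wit'(2) that by (simp flip: mat_mult_index_sum[OF Q P])
  have MPD: "?M * P = P * ?D" by (rule similar_mat_wit_commute[OF M wit])
  have MP: "(\<Sum>k<?n. ?M $$ (i, k) * P $$ (k, j)) = ds ! j * P $$ (i, j)" if "i < ?n" "j < ?n" for i j
  proof -
    have "(\<Sum>k<?n. ?M $$ (i, k) * P $$ (k, j)) = (\<Sum>k<?n. P $$ (i, k) * ?D $$ (k, j))"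
      using MPD by (simp only: that flip: mat_mult_index_sum[OF M P] mat_mult_index_sum[OF P D])
    also have "\<dots> = (\<Sum>k<?n. if k = j then ds ! j * P $$ (i, j) else 0)"
      using that by (intro sum.cong) auto
    finally show ?thesis using that by simp
  qed
  have QMD: "Q * ?M = ?D * Q" by (rule similar_mat_wit_commute[OF M wit])
  have QM: "(\<Sum>k<?n. Q $$ (i, k) * ?M $$ (k, j)) = ds ! i * Q $$ (i, j)" if "i < ?n" "j < ?n" for i j
  proof -
    have "(\<Sum>k<?n. Q $$ (i, k) * ?M $$ (k, j)) = (\<Sum>k<?n. ?D $$ (i, k) * Q $$ (k, j))"
      using QMD by (simp only: that flip: mat_mult_index_sum[OF Q M] mat_mult_index_sum[OF D Q])
    also have "\<dots> = (\<Sum>k<?n. if k = i then ds ! i * Q $$ (i, j) else 0)"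
      using that by (intro sum.cong) auto
    finally show ?thesis using that by simp
  qed
  have lap_nth: "Poly_Mapping.lookup (lap f) (vs ! i) = (\<Sum>k<?n. ?M $$ (i, k) * Poly_Mapping.lookup f (vs ! k))"
    if "i < ?n" for f i
    unfolding lookup_laplacian vs(2)[symmetric] sum_nth_distinct[OF vs(1), symmetric]
    using that by (simp add: fmat_def atLeast0LessThan)
  have eqI: "f = g" if "f \<in> chains (verts G)" "g \<in> chains (verts G)"
      "\<And>j. j < ?n \<Longrightarrow> Poly_Mapping.lookup f (vs ! j) = Poly_Mapping.lookup g (vs ! j)" for f g :: "'a \<Rightarrow>\<^sub>0 real"
    using that by (intro chains_verts_eqI) (metis in_set_conv_nth vs(2))+
  define b where "b i = (\<Sum>j<?n. Poly_Mapping.single (vs ! j) (P $$ (j, i)))" for i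
  have b: "Poly_Mapping.lookup (b i) (vs ! j) = P $$ (j, i)" if "j < ?n" for i j
    unfolding b_def lookup_sum lookup_single when_def
    using that vs(1) by (simp add: nth_eq_iff_index_eq cong: if_cong)
  have b_chain: "b i \<in> chains (verts G)" for i
  proof -
    have "Poly_Mapping.lookup (b i) v = 0" if "v \<notin> verts G" for v
      unfolding b_def lookup_sum lookup_single when_def
      using that vs(2) by (intro sum.neutral) auto
    then show ?thesis by (auto simp: chains_iff)
  qed
  define S where "S = {i. i < ?n \<and> ds ! i = x}"
  have S: "finite S" "S \<subseteq> {..<?n}" by (auto simp: S_def)
  \<comment> \<open>Row \<open>k\<close> of \<open>Q\<close> is dual to the columns of
    \<open>P\<close> and reads off the coefficient \<open>u k\<close>.\<close>
  have coeff: "u k = 0" if "(\<Sum>i\<in>S. u i *\<^sub>R b i) = 0" "k \<in> S" for u :: "nat \<Rightarrow> real" and k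
  proof -
    have "u k = (\<Sum>i\<in>S. u i * (\<Sum>j<?n. Q $$ (k, j) * P $$ (j, i)))"
      using S that(2) by (subst sum.cong[OF refl, of _ _ "\<lambda>i. if k = i then u i else 0"]) (auto simp: QP subset_eq)
    also have "\<dots> = (\<Sum>j<?n. Q $$ (k, j) * Poly_Mapping.lookup (\<Sum>i\<in>S. u i *\<^sub>R b i) (vs ! j))"
      by (simp add: lookup_sum lookup_scaleR_real b sum_distrib_left mult_ac) (rule sum.swap)
    also have "\<dots> = 0" using that(1) by simp
    finally show ?thesis .
  qed
  have inj: "inj_on b S"
  proof (rule inj_onI, rule ccontr)
    fix i k assume ik: "i \<in> S" "k \<in> S" "b i = b k" "i \<noteq> k"
    have "(\<Sum>l\<in>S. (if l = i then 1 else if l = k then -1 else 0) *\<^sub>R b l) =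
        (\<Sum>l\<in>S. (if l = i then b i else 0) - (if l = k then b k else 0))"
      using ik(4) by (intro sum.cong) auto
    also have "\<dots> = 0" using ik S(1) by (simp add: sum_subtractf)
    finally show False using coeff[of "\<lambda>l. if l = i then 1 else if l = k then -1 else 0" i] ik by auto
  qed
  have "dim (eigenspace G arev Ep we wv x) = card S"
  proof (rule dim_unique[of "b ` S"])
    show "b ` S \<subseteq> eigenspace G arev Ep we wv x"
    proof
      fix f assume "f \<in> b ` S"
      then obtain i where i: "i < ?n" "ds ! i = x" "f = b i" by (auto simp: S_def)
      have "lap (b i) = x *\<^sub>R b i"
      proof (rule eqI[OF laplacian_chains])
        show "x *\<^sub>R b i \<in> chains (verts G)"
          using b_chain[of i] by (simp add: chains_iff lookup_scaleR_real)
        show "Poly_Mapping.lookup (lap (b i)) (vs ! j) = Poly_Mapping.lookup (x *\<^sub>R b i) (vs ! j)" if "j < ?n" for j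
          using that i by (simp add: lap_nth b MP lookup_scaleR_real)
      qed
      then show "f \<in> eigenspace G arev Ep we wv x" using i b_chain by (simp add: eigenspace_def)
    qed
    show "eigenspace G arev Ep we wv x \<subseteq> span (b ` S)"
    proof
      fix f assume "f \<in> eigenspace G arev Ep we wv x"
      then have ch: "f \<in> chains (verts G)" and lap: "lap f = x *\<^sub>R f" by (auto simp: eigenspace_def)
      \<comment> \<open>These are the coordinates of \<open>f\<close> in the eigenbasis. Applying
        \<open>Q * ?M = ?D * Q\<close> gives \<open>ds ! i * c i = x * c i\<close>, so they vanish
        outside \<open>S\<close>.\<close>
      define c where "c i = (\<Sum>j<?n. Q $$ (i, j) * Poly_Mapping.lookup f (vs ! j))" for i
      have "c i = 0" if "i < ?n" "i \<notin> S" for i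
      proof -
        have "ds ! i * c i = (\<Sum>j<?n. (\<Sum>k<?n. Q $$ (i, k) * ?M $$ (k, j)) * Poly_Mapping.lookup f (vs ! j))"
          using that(1) by (simp add: c_def sum_distrib_left QM mult.assoc)
        also have "\<dots> = (\<Sum>k<?n. Q $$ (i, k) * Poly_Mapping.lookup (lap f) (vs ! k))"
          by (simp add: lap_nth sum_distrib_left sum_distrib_right mult.assoc) (rule sum.swap)
        also have "\<dots> = x * c i"
          by (simp add: lap lookup_scaleR_real c_def sum_distrib_left mult_ac)
        finally show ?thesis using that by (simp add: S_def)
      qed
      then have sum_S: "(\<Sum>i<?n. c i *\<^sub>R b i) = (\<Sum>i\<in>S. c i *\<^sub>R b i)"
        using S by (intro sum.mono_neutral_right) auto
      have "f = (\<Sum>i<?n. c i *\<^sub>R b i)"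
      proof (rule eqI[OF ch])
        have "Poly_Mapping.lookup (\<Sum>i<?n. c i *\<^sub>R b i) v = 0" if "v \<notin> verts G" for v
          using that b_chain by (auto simp: lookup_sum lookup_scaleR_real chains_iff intro!: sum.neutral)
        then show "(\<Sum>i<?n. c i *\<^sub>R b i) \<in> chains (verts G)" by (auto simp: chains_iff)
        fix j assume j: "j < ?n"
        have "Poly_Mapping.lookup (\<Sum>i<?n. c i *\<^sub>R b i) (vs ! j) =
            (\<Sum>i<?n. \<Sum>k<?n. P $$ (j, i) * Q $$ (i, k) * Poly_Mapping.lookup f (vs ! k))"
          using j by (simp add: lookup_sum lookup_scaleR_real b c_def sum_distrib_left sum_distrib_right mult_ac)
        also have "\<dots> = (\<Sum>k<?n. (\<Sum>i<?n. P $$ (j, i) * Q $$ (i, k)) * Poly_Mapping.lookup f (vs ! k))"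
          by (subst sum.swap) (simp add: sum_distrib_right)
        also have "\<dots> = (\<Sum>k<?n. if j = k then Poly_Mapping.lookup f (vs ! k) else 0)"
          using j by (intro sum.cong) (auto simp: PQ)
        also have "\<dots> = Poly_Mapping.lookup f (vs ! j)" using j by simp
        finally show "Poly_Mapping.lookup f (vs ! j) = Poly_Mapping.lookup (\<Sum>i<?n. c i *\<^sub>R b i) (vs ! j)" ..
      qed
      then show "f \<in> span (b ` S)"
        unfolding sum_S by (simp add: span_sum span_scale span_base)
    qed
    show "independent (b ` S)"
    proof
      assume "dependent (b ` S)"
      then obtain u f where "(\<Sum>v\<in>b ` S. u v *\<^sub>R v) = 0" "f \<in> b ` S" "u f \<noteq> 0"
        using S(1) by (auto simp: dependent_finite)
      then show False using coeff[of "\<lambda>i. u (b i)"] by (auto simp: sum.reindex[OF inj])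
    qed
    show "card (b ` S) = card S" by (rule card_image[OF inj])
  qed
  then show ?thesis by (simp add: count_list_eq_card S_def ds)
qed

section \<open>The product of the nonzero eigenvalues\<close>

lemma nonzero_eigenvalues_pos:
  assumes lam: "nonzero_eigenvalues G arev Ep we wv lam" and x: "x \<in> set lam"
  shows "0 < x"
proof -
  have "count_list lam x \<noteq> 0" using x by (simp add: count_list_0_iff)
  then have x0: "x \<noteq> 0" and dim: "dim (eigenspace G arev Ep we wv x) \<noteq> 0"
    using lam by (auto simp: nonzero_eigenvalues_def split: if_splits)
  have "\<not> eigenspace G arev Ep we wv x \<subseteq> {0}"
  proof
    assume "eigenspace G arev Ep we wv x \<subseteq> {0}"
    then have "dim (eigenspace G arev Ep we wv x) = 0"
      by (intro dim_unique[of "{}"] independent_empty) auto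
    with dim show False by simp
  qed
  then have "0 \<le> x" using eigenvalue_nonneg by blast
  with x0 show ?thesis by simp
qed

lemma laplacian_char_poly:
  assumes lam: "nonzero_eigenvalues G arev Ep we wv lam" and vs: "distinct vs" "set vs = verts G"
  shows "length vs = Suc (length lam)"
    and "char_poly (fmat vs vs (\<lambda>u v. edge_form G Ep we u v * real (wv v))) = (\<Prod>a\<leftarrow>0 # lam. [:- a, 1:])"
proof -
  let ?n = "length vs"
  let ?M = "fmat vs vs (\<lambda>u v. edge_form G Ep we u v * real (wv v))"
  have M: "?M \<in> carrier_mat ?n ?n" by simp
  have sym: "edge_form G Ep we u v = edge_form G Ep we v u" for u v
    by (simp add: edge_form_def mult.commute)
  obtain ds P Q where ds: "length ds = ?n"
    and wit: "similar_mat_wit ?M (mat ?n ?n (\<lambda>(i, j). if i = j then ds ! i else 0)) P Q"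
  \<comment> \<open>The vertex weights symmetrize: multiplying the row of \<open>u\<close> by its
    weight gives \<open>edge_form\<close> with the weights of both \<open>u\<close> and
    \<open>v\<close>.\<close>
  proof (rule symmetrizable_diagonalizable[OF M, of "\<lambda>i. real (wv (vs ! i))"])
    show "0 < real (wv (vs ! i))" if "i < ?n" for i
      using that vs(2) wv_pos by (metis nth_mem of_nat_0_less_iff)
    show "real (wv (vs ! i)) * ?M $$ (i, j) = real (wv (vs ! j)) * ?M $$ (j, i)" if "i < ?n" "j < ?n" for i j
      using that sym[of "vs ! i" "vs ! j"] by (simp add: fmat_def)
  qed
  let ?D = "mat ?n ?n (\<lambda>(i, j). if i = j then ds ! i else 0)"
  note count = dim_eigenspace[OF vs ds wit]
  \<comment> \<open>Multiplicities are dimensions of eigenspaces. The list \<open>lam\<close>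
    accounts for the nonzero values, and the single 0 for the one-dimensional kernel.\<close>
  have "mset ds = mset (0 # lam)"
  proof (rule multiset_eqI)
    fix x
    show "count (mset ds) x = count (mset (0 # lam)) x"
      using lam count[of x] dim_kernel by (auto simp: nonzero_eigenvalues_def count_mset)
  qed
  then show "length vs = Suc (length lam)"
    using ds by (metis length_Cons size_mset)
  have "char_poly ?M = char_poly ?D"
    using wit by (intro char_poly_similar) (auto simp: similar_mat_def)
  also have "\<dots> = (\<Prod>a\<leftarrow>diag_mat ?D. [:- a, 1:])"
    by (rule char_poly_upper_triangular[of _ ?n]) auto
  also have "diag_mat ?D = ds"
    using ds by (intro nth_equalityI) (auto simp: diag_mat_def)
  also have "(\<Prod>a\<leftarrow>ds. [:- a, 1:]) = (\<Prod>a\<in>#mset ds. [:- a, 1:])"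
    by (simp flip: mset_map add: prod_mset_prod_list)
  also have "\<dots> = (\<Prod>a\<leftarrow>0 # lam. [:- a, 1:])"
    unfolding \<open>mset ds = mset (0 # lam)\<close> by (simp flip: mset_map add: prod_mset_prod_list)
  finally show "char_poly ?M = (\<Prod>a\<leftarrow>0 # lam. [:- a, 1:])" .
qed

lemma prod_eigenvalues:
  assumes lam: "nonzero_eigenvalues G arev Ep we wv lam" and \<phi>: "int_basis (H1 G Ep) \<phi>"
  shows "real_of_int (Determinant.det (gram we \<phi>)) * (\<Sum>v\<in>verts G. \<Prod>v'\<in>verts G - {v}. real (wv v')) =
    prod_list lam * (\<Prod>e\<in>Ep. real (we e))"
proof -
  obtain vs where vs: "distinct vs" "set vs = verts G"
    using finite_distinct_list[OF finite_verts] by auto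
  let ?n = "length vs"
  let ?M = "fmat vs vs (\<lambda>u v. edge_form G Ep we u v * real (wv v))"
  let ?d = "real_of_int (Determinant.det (gram we \<phi>))" and ?W = "\<Prod>e\<in>Ep. real (we e)"
  have n: "?n = Suc (length lam)" and cp: "char_poly ?M = (\<Prod>a\<leftarrow>0 # lam. [:- a, 1:])"
    using laplacian_char_poly[OF lam vs] by auto
  have "?W * Determinant.det (mat_delete ?M i i) = ?d * (\<Prod>v'\<in>verts G - {vs ! i}. real (wv v'))" if i: "i < ?n" for i
  proof -
    define us where "us = take i vs @ drop (Suc i) vs"
    note split = id_take_nth_drop[OF i]
    have dist: "distinct (take i vs @ vs ! i # drop (Suc i) vs)"
      unfolding split[symmetric] by (rule vs)
    have set: "set (take i vs @ vs ! i # drop (Suc i) vs) = verts G"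
      unfolding split[symmetric] by (rule vs)
    have us: "distinct us" using dist by (simp add: us_def)
    have "vs ! i \<notin> set us" "insert (vs ! i) (set us) = verts G"
      using dist set by (simp_all add: us_def)
    then have set_us: "set us = verts G - {vs ! i}" by blast
    have r: "vs ! i \<in> verts G" using nth_mem[OF i] unfolding vs(2) .
    \<comment> \<open>Vertex weights scale columns, so deleting row and column \<open>i\<close>
      leaves a product of the reduced \<open>edge_form\<close> matrix and a diagonal matrix.\<close>
    have "mat_delete ?M i i = fmat us us (edge_form G Ep we) *
        fmat us us (\<lambda>u v. if u = v then real (wv u) else 0)"
      unfolding us_def[symmetric] fmat_mult_diag[OF us] mat_delete_fmat[OF i] ..
    then have "Determinant.det (mat_delete ?M i i) =
        Determinant.det (fmat us us (edge_form G Ep we)) * (\<Prod>v'\<in>set us. real (wv v'))"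
      by (simp only: det_mult[OF fmat_carrier fmat_carrier] det_fmat_diag[OF us])
    then show ?thesis
      using det_gram_H1[OF \<phi> us set_us r] set_us by simp
  qed
  then have "?W * (\<Sum>i<?n. Determinant.det (mat_delete ?M i i)) =
      (\<Sum>i<?n. ?d * (\<Prod>v'\<in>verts G - {vs ! i}. real (wv v')))"
    by (simp add: sum_distrib_left)
  also have "\<dots> = ?d * (\<Sum>v\<in>verts G. \<Prod>v'\<in>verts G - {v}. real (wv v'))"
    using sum_nth_distinct[OF vs(1), of "\<lambda>v. \<Prod>v'\<in>verts G - {v}. real (wv v')"]
    by (simp add: vs(2) atLeast0LessThan flip: sum_distrib_left)
  moreover have "?M \<in> carrier_mat (Suc (length lam)) (Suc (length lam))"
    unfolding n[symmetric] by (rule fmat_carrier)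
  ultimately show ?thesis
    using sum_principal_minors[OF _ cp refl] unfolding n by (simp only: mult.commute)
qed

end

lemma pos_of_mult_pos: "0 < a * b \<Longrightarrow> 0 \<le> b \<Longrightarrow> 0 < (a::'a::linordered_idom)"
  by (simp add: zero_less_mult_iff)

theorem theorem3p1:
  fixes G :: "('a, 'b) pre_digraph" and arev :: "'b \<Rightarrow> 'b" and Ep :: "'b set"
    and we :: "'b \<Rightarrow> nat" and wv :: "'a \<Rightarrow> nat" and n :: nat and lam :: "real list"
  assumes "weighted_graph G arev Ep we wv"
    and "card (verts G) = n"
    and "nonzero_eigenvalues G arev Ep we wv lam"
  shows "length lam = n - 1 \<and> (\<forall>i<n - 1. 0 < lam ! i) \<and>
    real_of_int (discriminant G Ep we) * (\<Sum>v\<in>verts G. \<Prod>v'\<in>verts G - {v}. real (wv v')) =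
    (\<Prod>i<n - 1. lam ! i) * (\<Prod>e\<in>Ep. real (we e))"
proof -
  interpret weighted_graph G arev Ep we wv by (rule assms(1))
  note lam = assms(3)
  obtain vs where vs: "distinct vs" "set vs = verts G"
    using finite_distinct_list[OF finite_verts] by auto
  have len: "length lam = n - 1"
    using laplacian_char_poly(1)[OF lam vs] vs assms(2) distinct_card by fastforce
  have pos: "0 < lam ! i" if "i < n - 1" for i
    using nonzero_eigenvalues_pos[OF lam] that len by simp
  obtain \<phi> where \<phi>: "int_basis (H1 G Ep) \<phi>" using H1_basis_exists by blast
  have prod: "prod_list lam = (\<Prod>i<n - 1. lam ! i)"
    by (simp add: prod.list_conv_set_nth len atLeast0LessThan)
  let ?d = "real_of_int (Determinant.det (gram we \<phi>))"
    and ?V = "\<Sum>v\<in>verts G. \<Prod>v'\<in>verts G - {v}. real (wv v')"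
  have eq: "?d * ?V = (\<Prod>i<n - 1. lam ! i) * (\<Prod>e\<in>Ep. real (we e))"
    using prod_eigenvalues[OF lam \<phi>] prod by simp
  \<comment> \<open>the Gram determinant is positive because the right-hand side is, which disposes of the
    absolute value in the discriminant\<close>
  have "0 < (\<Prod>i<n - 1. lam ! i) * (\<Prod>e\<in>Ep. real (we e))"
    using pos we_pos Ep_arcs by (intro mult_pos_pos prod_pos) auto
  then have "0 < ?d * ?V" by (simp only: eq)
  moreover have "0 \<le> ?V" by (intro sum_nonneg prod_nonneg) simp
  ultimately have "0 < ?d" by (rule pos_of_mult_pos)
  then have "real_of_int (discriminant G Ep we) = ?d"
    by (simp add: discriminant_eq[OF \<phi>])
  then show ?thesis using len pos eq by simp
qed

end
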